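(* Let $A$ be a finite abelian group, $Q$ a finite group acting on $A$, and $[\pi]\in H^1(Q,\check{A})$ a bijective class. Then for every $[\beta]\in H^2(Q,A)$ such that $[\beta]\cup[\pi]=0\in H^3(Q,\mathbb{C}^* )$, the group $G$ determined by the extension $[\beta]:1\to A\to G\to Q\to 1$ is of central type.
   Context: All groups act trivially on $\mathbb{C}^*$. $\check{A}=\mathrm{Hom}(A,\mathbb{C}^* )$ is a $Q$-module via $\langle g(\chi),a\rangle=\langle\chi,g^{-1}(a)\rangle$, where $\langle\chi,a\rangle=\chi(a)$. The product $[\beta]\cup[\pi]\in H^3(Q,\mathbb{C}^* )$ is the cup product followed by the pairing of $A$ with $\check A$; it is represented by the 3-cocycle $(g_1,g_2,g_3)\mapsto\langle\pi(g_1),g_1(\beta(g_2,g_3))\rangle$. A class $[\pi]\in H^1(Q,\check A)$ is bijective if the 1-cocycle $\pi:Q\to\check A$ (satisfying $\pi(g_1g_2)=\pi(g_1)\,g_1(\pi(g_2))$) is a bijective map; this does not depend on the representative. A class $[c]\in H^2(G,\mathbb{C}^* )$ is non-degenerate if the twisted group algebra $\mathbb{C}^c[G]$ (with basis $\{U_\gamma\}_{\gamma\in G}$ and $U_\sigma U_\gamma=c(\sigma,\gamma)U_{\sigma\gamma}$) is isomorphic to a full matrix algebra $M_n(\mathbb{C})$, $n=\sqrt{|G|}$. A finite group $G$ is of central type if it admits a non-degenerate class $[c]\in H^2(G,\mathbb{C}^* )$. *)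

theory Defs
  imports "HOL-Algebra.Algebra" "Jordan_Normal_Form.Matrix"
begin

text \<open>
  Throughout, a \<open>Q\<close>-module is a commutative group \<open>M\<close> with a homomorphism
  \<open>\<phi> \<in> hom Q (AutoGroup M)\<close>. Cohomology is that of the inhomogeneous bar complex: an
  \<open>n\<close>-cochain is a function on the lists of \<open>n\<close> elements of \<open>Q\<close>, extensional so that cochains are
  determined by their values on these lists. \<open>M\<close> is written multiplicatively.
\<close>

definition tuples :: "('q, 'b) monoid_scheme \<Rightarrow> nat \<Rightarrow> 'q list set" where
  "tuples Q n = {gs. set gs \<subseteq> carrier Q \<and> length gs = n}"

definition cochains ::
  "('q, 'b) monoid_scheme \<Rightarrow> ('m, 'c) monoid_scheme \<Rightarrow> nat \<Rightarrow> ('q list \<Rightarrow> 'm) monoid" where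
  "cochains Q M n = product_group (tuples Q n) (\<lambda>_. M)"

text \<open>Replaces the two entries of \<open>gs\<close> at positions \<open>i\<close> and \<open>i + 1\<close> by their product.\<close>

definition merge_at :: "('q, 'b) monoid_scheme \<Rightarrow> nat \<Rightarrow> 'q list \<Rightarrow> 'q list" where
  "merge_at Q i gs = take i gs @ (gs ! i \<otimes>\<^bsub>Q\<^esub> gs ! Suc i) # drop (i + 2) gs"

definition coboundary ::
  "('q, 'b) monoid_scheme \<Rightarrow> ('m, 'c) monoid_scheme \<Rightarrow> ('q \<Rightarrow> 'm \<Rightarrow> 'm) \<Rightarrow> nat \<Rightarrow>
    ('q list \<Rightarrow> 'm) \<Rightarrow> 'q list \<Rightarrow> 'm" where
  "coboundary Q M \<phi> n f = (\<lambda>gs \<in> tuples Q (Suc n).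
     \<phi> (hd gs) (f (tl gs))
     \<otimes>\<^bsub>M\<^esub> (\<Otimes>\<^bsub>M\<^esub>i \<in> {..<n}. f (merge_at Q i gs) [^]\<^bsub>M\<^esub> ((- 1) ^ (i + 1) :: int))
     \<otimes>\<^bsub>M\<^esub> f (butlast gs) [^]\<^bsub>M\<^esub> ((- 1) ^ (n + 1) :: int))"

definition cocycles ::
  "('q, 'b) monoid_scheme \<Rightarrow> ('m, 'c) monoid_scheme \<Rightarrow> ('q \<Rightarrow> 'm \<Rightarrow> 'm) \<Rightarrow> nat \<Rightarrow>
    ('q list \<Rightarrow> 'm) set" where
  "cocycles Q M \<phi> n =
     {f \<in> carrier (cochains Q M n). coboundary Q M \<phi> n f = \<one>\<^bsub>cochains Q M (Suc n)\<^esub>}"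

definition coboundaries ::
  "('q, 'b) monoid_scheme \<Rightarrow> ('m, 'c) monoid_scheme \<Rightarrow> ('q \<Rightarrow> 'm \<Rightarrow> 'm) \<Rightarrow> nat \<Rightarrow>
    ('q list \<Rightarrow> 'm) set" where
  "coboundaries Q M \<phi> n =
     (case n of 0 \<Rightarrow> {\<one>\<^bsub>cochains Q M 0\<^esub>}
      | Suc k \<Rightarrow> coboundary Q M \<phi> k ` carrier (cochains Q M k))"

definition cohomology ::
  "('q, 'b) monoid_scheme \<Rightarrow> ('m, 'c) monoid_scheme \<Rightarrow> ('q \<Rightarrow> 'm \<Rightarrow> 'm) \<Rightarrow> nat \<Rightarrow>
    ('q list \<Rightarrow> 'm) set monoid" where
  "cohomology Q M \<phi> n =
     (cochains Q M n)\<lparr>carrier := cocycles Q M \<phi> n\<rparr> Mod coboundaries Q M \<phi> n"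

definition cohomology_class ::
  "('q, 'b) monoid_scheme \<Rightarrow> ('m, 'c) monoid_scheme \<Rightarrow> ('q \<Rightarrow> 'm \<Rightarrow> 'm) \<Rightarrow> nat \<Rightarrow>
    ('q list \<Rightarrow> 'm) \<Rightarrow> ('q list \<Rightarrow> 'm) set" where
  "cohomology_class Q M \<phi> n f = coboundaries Q M \<phi> n #>\<^bsub>cochains Q M n\<^esub> f"

definition Cstar :: "complex monoid" where
  "Cstar = \<lparr>carrier = UNIV - {0}, monoid.mult = (*), one = 1\<rparr>"

definition trivial_action :: "'q \<Rightarrow> 'm \<Rightarrow> 'm" where
  "trivial_action g = id"

definition dual_group :: "('a, 'b) monoid_scheme \<Rightarrow> ('a \<Rightarrow> complex) monoid" where
  "dual_group A = (product_group (carrier A) (\<lambda>_. Cstar))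
     \<lparr>carrier := hom A Cstar \<inter> extensional (carrier A)\<rparr>"

definition dual_action ::
  "('q, 'c) monoid_scheme \<Rightarrow> ('a, 'b) monoid_scheme \<Rightarrow> ('q \<Rightarrow> 'a \<Rightarrow> 'a) \<Rightarrow>
    'q \<Rightarrow> ('a \<Rightarrow> complex) \<Rightarrow> 'a \<Rightarrow> complex" where
  "dual_action Q A \<phi> g \<chi> = (\<lambda>a \<in> carrier A. \<chi> (\<phi> (inv\<^bsub>Q\<^esub> g) a))"

definition cup_cochain ::
  "('q, 'c) monoid_scheme \<Rightarrow> ('q \<Rightarrow> 'a \<Rightarrow> 'a) \<Rightarrow>
    ('q list \<Rightarrow> 'a) \<Rightarrow> ('q list \<Rightarrow> 'a \<Rightarrow> complex) \<Rightarrow> 'q list \<Rightarrow> complex" where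
  "cup_cochain Q \<phi> \<beta> \<pi> =
     (\<lambda>gs \<in> tuples Q 3. \<pi> [gs ! 0] (\<phi> (gs ! 0) (\<beta> [gs ! 1, gs ! 2])))"

text \<open>
  The product of classes \<open>B \<in> H\<^sup>2(Q, A)\<close> and \<open>P \<in> H\<^sup>1(Q, Hom(A, \<complex>\<^sup>*))\<close>. All sets in the union
  coincide, as the class of the cup cochain does not depend on the representatives.
\<close>

definition cup_class ::
  "('q, 'c) monoid_scheme \<Rightarrow> ('q \<Rightarrow> 'a \<Rightarrow> 'a) \<Rightarrow>
    ('q list \<Rightarrow> 'a) set \<Rightarrow> ('q list \<Rightarrow> 'a \<Rightarrow> complex) set \<Rightarrow> ('q list \<Rightarrow> complex) set" where
  "cup_class Q \<phi> B P =
     (\<Union>\<beta> \<in> B. \<Union>\<pi> \<in> P. cohomology_class Q Cstar trivial_action 3 (cup_cochain Q \<phi> \<beta> \<pi>))"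

definition bijective_class ::
  "('q, 'c) monoid_scheme \<Rightarrow> ('a, 'b) monoid_scheme \<Rightarrow> ('q list \<Rightarrow> 'a \<Rightarrow> complex) set \<Rightarrow> bool" where
  "bijective_class Q A P \<longleftrightarrow>
     (\<exists>\<pi> \<in> P. bij_betw (\<lambda>g. \<pi> [g]) (carrier Q) (carrier (dual_group A)))"

text \<open>
  \<open>1 \<rightarrow> A \<rightarrow> G \<rightarrow> Q \<rightarrow> 1\<close> is exact, and conjugation in \<open>G\<close> induces the given action of \<open>Q\<close> on \<open>A\<close>.
\<close>

definition group_extension ::
  "('a, 'b) monoid_scheme \<Rightarrow> ('q, 'c) monoid_scheme \<Rightarrow> ('q \<Rightarrow> 'a \<Rightarrow> 'a) \<Rightarrow>
    ('g, 'd) monoid_scheme \<Rightarrow> ('a \<Rightarrow> 'g) \<Rightarrow> ('g \<Rightarrow> 'q) \<Rightarrow> bool" where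
  "group_extension A Q \<phi> G \<iota> p \<longleftrightarrow>
     group G \<and> \<iota> \<in> mon A G \<and> p \<in> epi G Q \<and> kernel G Q p = \<iota> ` carrier A \<and>
     (\<forall>x \<in> carrier G. \<forall>a \<in> carrier A. x \<otimes>\<^bsub>G\<^esub> \<iota> a \<otimes>\<^bsub>G\<^esub> inv\<^bsub>G\<^esub> x = \<iota> (\<phi> (p x) a))"

text \<open>The cochain \<open>\<beta>\<close> with \<open>s(g) s(h) = \<beta>(g, h) s(g h)\<close>.\<close>

definition factor_set ::
  "('a, 'b) monoid_scheme \<Rightarrow> ('q, 'c) monoid_scheme \<Rightarrow> ('g, 'd) monoid_scheme \<Rightarrow>
    ('a \<Rightarrow> 'g) \<Rightarrow> ('q \<Rightarrow> 'g) \<Rightarrow> 'q list \<Rightarrow> 'a" where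
  "factor_set A Q G \<iota> s = (\<lambda>gs \<in> tuples Q 2. the_inv_into (carrier A) \<iota>
     (s (gs ! 0) \<otimes>\<^bsub>G\<^esub> s (gs ! 1) \<otimes>\<^bsub>G\<^esub> inv\<^bsub>G\<^esub> (s (gs ! 0 \<otimes>\<^bsub>Q\<^esub> gs ! 1))))"

definition extension_has_class ::
  "('a, 'b) monoid_scheme \<Rightarrow> ('q, 'c) monoid_scheme \<Rightarrow> ('q \<Rightarrow> 'a \<Rightarrow> 'a) \<Rightarrow>
    ('g, 'd) monoid_scheme \<Rightarrow> ('a \<Rightarrow> 'g) \<Rightarrow> ('g \<Rightarrow> 'q) \<Rightarrow> ('q list \<Rightarrow> 'a) set \<Rightarrow> bool" where
  "extension_has_class A Q \<phi> G \<iota> p B \<longleftrightarrow>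
     (\<exists>s. (\<forall>g \<in> carrier Q. s g \<in> carrier G \<and> p (s g) = g) \<and>
          cohomology_class Q A \<phi> 2 (factor_set A Q G \<iota> s) = B)"

text \<open>
  An element \<open>u\<close> of the twisted group algebra stands for \<open>\<Sum>\<gamma>. u(\<gamma>) U\<^sub>\<gamma>\<close>. As \<open>c\<close> need not be
  normalized, the unit is \<open>c(1, 1)\<^sup>-\<^sup>1 U\<^sub>1\<close>.
\<close>

definition twisted_group_algebra ::
  "('g, 'b) monoid_scheme \<Rightarrow> ('g list \<Rightarrow> complex) \<Rightarrow> (complex, 'g \<Rightarrow> complex) module" where
  "twisted_group_algebra G c =
     \<lparr>carrier = extensional (carrier G),
      monoid.mult = (\<lambda>u v. \<lambda>x \<in> carrier G.
        \<Sum>(\<sigma>, \<gamma>) \<in> {(\<sigma>, \<gamma>) \<in> carrier G \<times> carrier G. \<sigma> \<otimes>\<^bsub>G\<^esub> \<gamma> = x}. c [\<sigma>, \<gamma>] * u \<sigma> * v \<gamma>),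
      one = (\<lambda>x \<in> carrier G. if x = \<one>\<^bsub>G\<^esub> then inverse (c [\<one>\<^bsub>G\<^esub>, \<one>\<^bsub>G\<^esub>]) else 0),
      ring.zero = (\<lambda>x \<in> carrier G. 0),
      ring.add = (\<lambda>u v. \<lambda>x \<in> carrier G. u x + v x),
      module.smult = (\<lambda>k u. \<lambda>x \<in> carrier G. k * u x)\<rparr>"

definition algebra_isomorphic ::
  "(complex, 'a, 'b) module_scheme \<Rightarrow> (complex, 'c, 'd) module_scheme \<Rightarrow> bool" where
  "algebra_isomorphic R S \<longleftrightarrow>
     (\<exists>h \<in> ring_iso R S. \<forall>k. \<forall>u \<in> carrier R. h (k \<odot>\<^bsub>R\<^esub> u) = k \<odot>\<^bsub>S\<^esub> h u)"

definition nondegenerate_class ::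
  "('g, 'b) monoid_scheme \<Rightarrow> ('g list \<Rightarrow> complex) set \<Rightarrow> bool" where
  "nondegenerate_class G C \<longleftrightarrow>
     (\<exists>c \<in> C. \<exists>n. n\<^sup>2 = order G \<and>
        algebra_isomorphic (twisted_group_algebra G c) (module_mat TYPE(complex) n n))"

definition central_type :: "('g, 'b) monoid_scheme \<Rightarrow> bool" where
  "central_type G \<longleftrightarrow> group G \<and> finite (carrier G) \<and>
     (\<exists>C \<in> carrier (cohomology G Cstar trivial_action 2). nondegenerate_class G C)"

end

theory Submission
  imports Defs
begin

text \<open>
  Let \<open>f\<close> be a 2-cochain on \<open>Q\<close> whose coboundary is the cup cochain of \<open>\<beta>\<close> and \<open>\<pi>\<close>. On functions
  on \<open>Q\<close>, let \<open>x = \<iota>(a) s(g)\<close> act by the monomial matrix with entry \<open>\<pi>(m)(m a) / f(m, g)\<close> in row \<open>m\<close>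
  and column \<open>m g\<close>. Since \<open>\<pi>\<close> is a 1-cocycle and \<open>\<partial>f = \<langle>\<pi>, \<beta>\<rangle>\<close>, this is a projective representation of
  \<open>G\<close>. For fixed \<open>g\<close> its entries are, up to scaling the rows, the character table of \<open>A\<close>, because
  \<open>m \<mapsto> \<pi>(m) \<circ> m\<close> is a bijection from \<open>Q\<close> onto the characters. So the \<open>|Q|\<^sup>2\<close> matrices form a basis
  of the full matrix algebra, which is thereby a twisted group algebra of \<open>G\<close>.
\<close>

subsection \<open>Cochains in low degrees\<close>

lemma (in group) merge_at_in_tuples:
  assumes "gs \<in> tuples G (Suc n)" and "i < n"
  shows "merge_at G i gs \<in> tuples G n"
proof -
  have "gs ! i \<in> carrier G" "gs ! Suc i \<in> carrier G"
    using assms by (auto simp: tuples_def)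
  then show ?thesis
    using assms set_take_subset[of i gs] set_drop_subset[of "i + 2" gs]
    by (auto simp: tuples_def merge_at_def)
qed

text \<open>The bar differential is made explicit only where it is used: degree 0 compares
  representatives of \<open>P\<close>, degree 1 yields the crossed homomorphism rule, and degree 2
  serves both the cup equation and the cocycle \<open>c\<close>.\<close>

lemma coboundary_0:
  assumes "comm_group M" and "f [] \<in> carrier M" and "\<phi> g (f []) \<in> carrier M" and "g \<in> carrier Q"
  shows "coboundary Q M \<phi> 0 f [g] = \<phi> g (f []) \<otimes>\<^bsub>M\<^esub> inv\<^bsub>M\<^esub> f []"
proof -
  interpret M: comm_group M by fact
  show ?thesis
    using assms by (simp add: coboundary_def tuples_def M.int_pow_neg M.int_pow_1)
qed

lemma coboundary_1:
  assumes "comm_group M" and "group Q" and "g \<in> carrier Q" "h \<in> carrier Q"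
    and "\<And>x. x \<in> carrier Q \<Longrightarrow> f [x] \<in> carrier M" and "\<phi> g (f [h]) \<in> carrier M"
  shows "coboundary Q M \<phi> 1 f [g, h] =
    \<phi> g (f [h]) \<otimes>\<^bsub>M\<^esub> inv\<^bsub>M\<^esub> f [g \<otimes>\<^bsub>Q\<^esub> h] \<otimes>\<^bsub>M\<^esub> f [g]"
proof -
  interpret M: comm_group M by fact
  interpret Q: group Q by fact
  show ?thesis
    using assms
    by (simp add: coboundary_def tuples_def merge_at_def lessThan_Suc M.int_pow_neg M.int_pow_1)
qed

lemma coboundary_2:
  assumes "comm_group M" and "group Q" and "g \<in> carrier Q" "h \<in> carrier Q" "k \<in> carrier Q"
    and "\<And>x y. x \<in> carrier Q \<Longrightarrow> y \<in> carrier Q \<Longrightarrow> f [x, y] \<in> carrier M"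
    and "\<phi> g (f [h, k]) \<in> carrier M"
  shows "coboundary Q M \<phi> 2 f [g, h, k] =
    \<phi> g (f [h, k]) \<otimes>\<^bsub>M\<^esub> (inv\<^bsub>M\<^esub> f [g \<otimes>\<^bsub>Q\<^esub> h, k] \<otimes>\<^bsub>M\<^esub> f [g, h \<otimes>\<^bsub>Q\<^esub> k])
      \<otimes>\<^bsub>M\<^esub> inv\<^bsub>M\<^esub> f [g, h]"
proof -
  interpret M: comm_group M by fact
  interpret Q: group Q by fact
  have "{..<2::nat} = {0, 1}" by auto
  then show ?thesis
    using assms
    by (simp add: coboundary_def tuples_def merge_at_def M.int_pow_neg M.int_pow_1)
qed

lemma coboundary_one:
  assumes "comm_group M" and "group Q" and "\<And>g. g \<in> carrier Q \<Longrightarrow> \<phi> g \<one>\<^bsub>M\<^esub> = \<one>\<^bsub>M\<^esub>"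
  shows "coboundary Q M \<phi> n \<one>\<^bsub>cochains Q M n\<^esub> = \<one>\<^bsub>cochains Q M (Suc n)\<^esub>"
proof -
  interpret M: comm_group M by fact
  interpret Q: group Q by fact
  have "coboundary Q M \<phi> n (\<lambda>gs \<in> tuples Q n. \<one>\<^bsub>M\<^esub>) gs = \<one>\<^bsub>M\<^esub>" if gs: "gs \<in> tuples Q (Suc n)" for gs
  proof -
    have "hd gs \<in> carrier Q" "tl gs \<in> tuples Q n" "butlast gs \<in> tuples Q n"
      using gs by (auto simp: tuples_def length_Suc_conv dest: in_set_butlastD)
    moreover have "(\<Otimes>\<^bsub>M\<^esub>i \<in> {..<n}. (\<lambda>gs \<in> tuples Q n. \<one>\<^bsub>M\<^esub>) (merge_at Q i gs)
        [^]\<^bsub>M\<^esub> ((- 1) ^ (i + 1) :: int)) = \<one>\<^bsub>M\<^esub>"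
      using gs by (intro M.finprod_one_eqI) (simp add: Q.merge_at_in_tuples)
    ultimately show ?thesis
      using gs by (simp add: coboundary_def assms(3))
  qed
  then show ?thesis
    by (intro ext) (auto simp: cochains_def coboundary_def restrict_def)
qed

lemma one_in_coboundaries:
  assumes "comm_group M" and "group Q" and "\<And>g. g \<in> carrier Q \<Longrightarrow> \<phi> g \<one>\<^bsub>M\<^esub> = \<one>\<^bsub>M\<^esub>"
  shows "\<one>\<^bsub>cochains Q M (Suc n)\<^esub> \<in> coboundaries Q M \<phi> (Suc n)"
proof -
  interpret M: comm_group M by fact
  have "\<one>\<^bsub>cochains Q M n\<^esub> \<in> carrier (cochains Q M n)"
    by (simp add: cochains_def)
  then show ?thesis
    using coboundary_one[OF assms(1,2), of \<phi> n] assms(3)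
    by (auto simp: coboundaries_def intro!: rev_image_eqI)
qed

text \<open>A class is a translate of the coboundaries, which contain the trivial cochain. This is
  how explicit cochains (the factor set, the cup cochain, \<open>c\<close>) enter their
  classes.\<close>

lemma cochain_in_cohomology_class:
  assumes "comm_group M" and "group Q" and "\<And>g. g \<in> carrier Q \<Longrightarrow> \<phi> g \<one>\<^bsub>M\<^esub> = \<one>\<^bsub>M\<^esub>"
    and "f \<in> carrier (cochains Q M (Suc n))"
  shows "f \<in> cohomology_class Q M \<phi> (Suc n) f"
proof -
  interpret M: comm_group M by fact
  have "\<one>\<^bsub>cochains Q M (Suc n)\<^esub> \<otimes>\<^bsub>cochains Q M (Suc n)\<^esub> f = f"
    using assms(4) unfolding cochains_def
    by (intro monoid.l_one group.is_monoid product_group) auto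
  then show ?thesis
    using one_in_coboundaries[OF assms(1,2), of \<phi> n] assms(3)
    unfolding cohomology_class_def r_coset_def by blast
qed

text \<open>Restricting the carrier to cocycles leaves the multiplication of cochains untouched, so
  the cosets in the quotient are the translates in \<open>cohomology_class\<close>.\<close>

lemma carrier_cohomology:
  "carrier (cohomology Q M \<phi> n) = cohomology_class Q M \<phi> n ` cocycles Q M \<phi> n"
  by (auto simp: cohomology_def FactGroup_def RCOSETS_def cohomology_class_def r_coset_def)

lemma one_cohomology: "\<one>\<^bsub>cohomology Q M \<phi> n\<^esub> = coboundaries Q M \<phi> n"
  by (simp add: cohomology_def FactGroup_def)

subsection \<open>Characters of a finite abelian group\<close>

lemma Cstar_simps [simp]:
  "carrier Cstar = - {0}" "x \<otimes>\<^bsub>Cstar\<^esub> y = x * y" "\<one>\<^bsub>Cstar\<^esub> = 1"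
  by (auto simp: Cstar_def)

lemma comm_group_Cstar: "comm_group Cstar"
  by (rule comm_groupI) (auto, metis Compl_iff inverse_nonzero_iff_nonzero left_inverse singletonD)

lemma inv_Cstar [simp]: "x \<noteq> 0 \<Longrightarrow> inv\<^bsub>Cstar\<^esub> x = inverse x"
proof -
  interpret comm_group Cstar by (rule comm_group_Cstar)
  show "x \<noteq> 0 \<Longrightarrow> inv\<^bsub>Cstar\<^esub> x = inverse x" by (intro inv_equality) auto
qed

lemma nat_pow_Cstar [simp]: "x [^]\<^bsub>Cstar\<^esub> (n::nat) = x ^ n"
  by (induction n) (auto simp: Cstar_def nat_pow_def)

context group
begin

lemma char_nonzero: "\<chi> \<in> hom G Cstar \<Longrightarrow> a \<in> carrier G \<Longrightarrow> \<chi> a \<noteq> 0"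
  by (auto simp: hom_def)

lemma char_mult:
  "\<chi> \<in> hom G Cstar \<Longrightarrow> a \<in> carrier G \<Longrightarrow> b \<in> carrier G \<Longrightarrow> \<chi> (a \<otimes> b) = \<chi> a * \<chi> b"
  by (simp add: hom_def)

lemma char_one: "\<chi> \<in> hom G Cstar \<Longrightarrow> \<chi> \<one> = 1"
  using hom_one[of \<chi> G Cstar] comm_group_Cstar by (simp add: comm_group_def is_group)

lemma char_inv:
  assumes "\<chi> \<in> hom G Cstar" "a \<in> carrier G" shows "\<chi> (inv a) = inverse (\<chi> a)"
proof -
  have "\<chi> a * \<chi> (inv a) = 1"
    using assms char_mult[of \<chi> a "inv a"] char_one[of \<chi>] by simp
  then show ?thesis by (simp add: inverse_unique)
qed

text \<open>Translation by \<open>a\<close> permutes the group but multiplies the sum by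
  \<open>\<chi> a\<close>.\<close>

lemma sum_char_eq_0:
  assumes \<chi>: "\<chi> \<in> hom G Cstar" and a: "a \<in> carrier G" and ne: "\<chi> a \<noteq> 1"
  shows "(\<Sum>x \<in> carrier G. \<chi> x) = 0"
proof -
  have "bij_betw (\<lambda>x. a \<otimes> x) (carrier G) (carrier G)"
    using a by (intro bij_betw_byWitness[where f'="\<lambda>x. inv a \<otimes> x"]) (auto simp flip: m_assoc)
  then have "(\<Sum>x \<in> carrier G. \<chi> x) = (\<Sum>x \<in> carrier G. \<chi> (a \<otimes> x))"
    by (rule sum.reindex_bij_betw[symmetric])
  also have "\<dots> = \<chi> a * (\<Sum>x \<in> carrier G. \<chi> x)"
    by (simp add: sum_distrib_left char_mult[OF \<chi> a])
  finally show ?thesis using ne by simp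
qed

end

text \<open>Division of the exponent by \<open>n\<close>: multiples of \<open>n\<close> are absorbed
  by \<open>\<Gamma>\<close>, and a nonzero remainder would contradict the minimality of
  \<open>n\<close>. With \<open>f = fst\<close> this adjoins one argument and its value to the graph
  of a partial character.\<close>

lemma (in comm_group) adjoin_to_graph:
  assumes f: "f \<in> hom G H" and H: "group H" and \<Gamma>: "subgroup \<Gamma> G"
    and triv: "\<And>\<gamma>. \<gamma> \<in> \<Gamma> \<Longrightarrow> f \<gamma> = \<one>\<^bsub>H\<^esub> \<Longrightarrow> \<gamma> = \<one>"
    and e: "e \<in> carrier G" and n: "n > 0" and en: "e [^] (n::nat) \<in> \<Gamma>"
    and least: "\<And>k::nat. 0 < k \<Longrightarrow> k < n \<Longrightarrow> f e [^]\<^bsub>H\<^esub> k \<notin> f ` \<Gamma>"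
  defines "\<Gamma>' \<equiv> {\<gamma> \<otimes> e [^] (k::int) | \<gamma> k. \<gamma> \<in> \<Gamma>}"
  shows "subgroup \<Gamma>' G" and "\<And>\<gamma>. \<gamma> \<in> \<Gamma>' \<Longrightarrow> f \<gamma> = \<one>\<^bsub>H\<^esub> \<Longrightarrow> \<gamma> = \<one>"
    and "insert e \<Gamma> \<subseteq> \<Gamma>'"
proof -
  interpret f: group_hom G H f
    using f H by (simp add: group_hom_def group_hom_axioms_def is_group)
  note [simp] = subgroup.mem_carrier[OF \<Gamma>] subgroup.m_closed[OF \<Gamma>] subgroup.m_inv_closed[OF \<Gamma>]
    subgroup.one_closed[OF \<Gamma>]
  show "subgroup \<Gamma>' G"
  proof (rule subgroupI)
    show "\<Gamma>' \<subseteq> carrier G" using e by (auto simp: \<Gamma>'_def)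
    show "\<Gamma>' \<noteq> {}" using subgroup.one_closed[OF \<Gamma>] unfolding \<Gamma>'_def by blast
  next
    fix x assume "x \<in> \<Gamma>'"
    then obtain \<gamma> and k :: int where x: "x = \<gamma> \<otimes> e [^] k" "\<gamma> \<in> \<Gamma>" by (auto simp: \<Gamma>'_def)
    then have "inv x = inv \<gamma> \<otimes> e [^] (- k)" using e by (simp add: inv_mult int_pow_neg)
    then show "inv x \<in> \<Gamma>'" using x by (auto simp: \<Gamma>'_def)
  next
    fix x y assume "x \<in> \<Gamma>'" "y \<in> \<Gamma>'"
    then obtain \<gamma> \<delta> and k l :: int
      where x: "x = \<gamma> \<otimes> e [^] k" "\<gamma> \<in> \<Gamma>" "y = \<delta> \<otimes> e [^] l" "\<delta> \<in> \<Gamma>" by (auto simp: \<Gamma>'_def)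
    then have "x \<otimes> y = (\<gamma> \<otimes> \<delta>) \<otimes> e [^] (k + l)" using e by (simp add: int_pow_mult m_ac)
    then show "x \<otimes> y \<in> \<Gamma>'" using x by (auto simp: \<Gamma>'_def)
  qed
  show "insert e \<Gamma> \<subseteq> \<Gamma>'"
  proof (intro subsetI)
    fix x assume "x \<in> insert e \<Gamma>"
    then have "x = \<one> \<otimes> e [^] (1::int) \<or> x = x \<otimes> e [^] (0::int) \<and> x \<in> \<Gamma>"
      using e by auto
    then show "x \<in> \<Gamma>'" unfolding \<Gamma>'_def using subgroup.one_closed[OF \<Gamma>] by blast
  qed
  fix x assume "x \<in> \<Gamma>'" and x1: "f x = \<one>\<^bsub>H\<^esub>"
  then obtain \<gamma> and k :: int where x: "x = \<gamma> \<otimes> e [^] k" "\<gamma> \<in> \<Gamma>" by (auto simp: \<Gamma>'_def)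
  define q r where "q = k div int n" and "r = nat (k mod int n)"
  have k: "k = int n * q + int r" using n by (simp add: q_def r_def)
  have enq: "e [^] (int n * q) \<in> \<Gamma>"
    using subgroup_int_pow_closed[OF \<Gamma> en, of q] e by (simp add: int_pow_pow flip: int_pow_int)
  define \<delta> where "\<delta> = \<gamma> \<otimes> e [^] (int n * q)"
  have \<delta>: "\<delta> \<in> \<Gamma>" using enq x by (simp add: \<delta>_def)
  have x': "x = \<delta> \<otimes> e [^] r"
    using x e by (simp add: \<delta>_def k int_pow_mult m_assoc flip: int_pow_int)
  have "f \<delta> \<otimes>\<^bsub>H\<^esub> f e [^]\<^bsub>H\<^esub> r = \<one>\<^bsub>H\<^esub>"
    using x1 e \<delta> by (simp add: x' f.hom_nat_pow)
  then have "f e [^]\<^bsub>H\<^esub> r = f (inv \<delta>)"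
    using e \<delta> by (simp add: f.H.inv_solve_left' f.H.inv_unique')
      (metis f.H.inv_equality f.H.inv_inv f.H.nat_pow_closed f.hom_closed subgroup.mem_carrier[OF \<Gamma>])
  then have "f e [^]\<^bsub>H\<^esub> r \<in> f ` \<Gamma>" using subgroup.m_inv_closed[OF \<Gamma> \<delta>] by (simp only: imageI)
  moreover have "r < n" using n by (simp add: r_def nat_less_iff)
  ultimately have "r = 0" using least[of r] by auto
  then show "x = \<one>" using x' \<delta> x1 triv by simp
qed

lemma exists_root_of_unity_neq_1:
  assumes "(n::nat) > 1" shows "\<exists>z::complex. z ^ n = 1 \<and> z \<noteq> 1"
proof (rule ccontr)
  assume "\<not> ?thesis"
  then have "{z::complex. z ^ n = 1} = {1}" by auto
  then show False using card_roots_unity_eq[of n] assms by simp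
qed

text \<open>
  A character on a subgroup of \<open>A\<close> is encoded by its graph, a subgroup of \<open>A \<times> \<complex>\<^sup>*\<close> meeting
  the second factor trivially; a graph with projection to \<open>A\<close> of maximal size is total.
\<close>

lemma (in comm_group) exists_char_neq_1:
  assumes fin: "finite (carrier G)" and a: "a \<in> carrier G" "a \<noteq> \<one>"
  shows "\<exists>\<chi> \<in> hom G Cstar. \<chi> a \<noteq> 1"
proof -
  interpret C: comm_group Cstar by (rule comm_group_Cstar)
  interpret P: comm_group "G \<times>\<times> Cstar"
    using DirProd_group[OF is_group C.is_group]
    by (intro group.group_comm_groupI) (auto simp: m_comm mult.commute)
  have fst_hom: "fst \<in> hom (G \<times>\<times> Cstar) G" by (auto simp: hom_def)
  define graph where "graph \<Gamma> \<longleftrightarrow> subgroup \<Gamma> (G \<times>\<times> Cstar) \<and>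
    (\<forall>\<gamma> \<in> \<Gamma>. fst \<gamma> = \<one> \<longrightarrow> \<gamma> = \<one>\<^bsub>G \<times>\<times> Cstar\<^esub>)" for \<Gamma>
  have pow: "(x, z) [^]\<^bsub>G \<times>\<times> Cstar\<^esub> (n::nat) = (x [^] n, z ^ n)" for x z n
  proof (induction n)
    case (Suc n)
    then show ?case by (simp only: P.nat_pow_Suc nat_pow_Suc mult_DirProd Cstar_simps power_Suc2)
  qed simp
  \<comment> \<open>Here \<open>z\<close> is prescribed at \<open>x\<close>. The only constraint is
    at \<open>x [^] n\<close>, the first positive power of \<open>x\<close> in the domain of
    \<open>\<Gamma>\<close>, where \<open>z ^ n\<close> must agree with the old value.\<close>
  have extend: "\<exists>\<Gamma>'. graph \<Gamma>' \<and> insert (x, z) \<Gamma> \<subseteq> \<Gamma>'"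
    if "graph \<Gamma>" "x \<in> carrier G" "z \<noteq> 0" "n > 0" "(x [^] n, z ^ n) \<in> \<Gamma>"
      "\<And>k::nat. 0 < k \<Longrightarrow> k < n \<Longrightarrow> x [^] k \<notin> fst ` \<Gamma>" for \<Gamma> x z n
  proof -
    have \<Gamma>: "subgroup \<Gamma> (G \<times>\<times> Cstar)"
      and triv: "\<And>\<gamma>. \<gamma> \<in> \<Gamma> \<Longrightarrow> fst \<gamma> = \<one> \<Longrightarrow> \<gamma> = \<one>\<^bsub>G \<times>\<times> Cstar\<^esub>"
      using that(1) unfolding graph_def by blast+
    have e: "(x, z) \<in> carrier (G \<times>\<times> Cstar)" using that(2,3) by simp
    have en: "(x, z) [^]\<^bsub>G \<times>\<times> Cstar\<^esub> n \<in> \<Gamma>" using that(5) by (simp only: pow)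
    have least: "\<And>k::nat. 0 < k \<Longrightarrow> k < n \<Longrightarrow> fst (x, z) [^] k \<notin> fst ` \<Gamma>"
      using that(6) by simp
    note adjoin = P.adjoin_to_graph[OF fst_hom is_group \<Gamma> triv e \<open>n > 0\<close> en least]
    show ?thesis
      unfolding graph_def using adjoin by blast
  qed
  have graph_one: "graph {\<one>\<^bsub>G \<times>\<times> Cstar\<^esub>}"
    unfolding graph_def using P.triv_subgroup by auto
  \<comment> \<open>The construction starts on the subgroup generated by \<open>a\<close>, with a
    value \<open>z\<close> other than 1 such that \<open>z ^ ord a = 1\<close>.\<close>
  have "ord a > 1"
    using ord_ge_1[OF fin a(1)] ord_eq_1[OF a(1)] a(2) by linarith
  then obtain z where z: "z ^ ord a = (1::complex)" "z \<noteq> 1"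
    using exists_root_of_unity_neq_1 by blast
  have "z \<noteq> 0" using z \<open>ord a > 1\<close> by (auto simp: power_0_left)
  moreover have "a [^] k \<notin> fst ` {\<one>\<^bsub>G \<times>\<times> Cstar\<^esub>}" if "0 < k" "k < ord a" for k :: nat
    using that a pow_eq_id[OF a(1), of k] by (auto dest: dvd_imp_le)
  moreover have "(a [^] ord a, z ^ ord a) \<in> {\<one>\<^bsub>G \<times>\<times> Cstar\<^esub>}"
    using z a by simp
  ultimately obtain \<Gamma>0 where \<Gamma>0: "graph \<Gamma>0" "(a, z) \<in> \<Gamma>0"
    using extend[OF graph_one a(1), of z "ord a"] \<open>ord a > 1\<close> by auto
  have sub: "fst ` \<Gamma> \<subseteq> carrier G" if "graph \<Gamma>" for \<Gamma>
    using that subgroup.subset[of \<Gamma> "G \<times>\<times> Cstar"] unfolding graph_def by auto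
  \<comment> \<open>Size is measured on the projection to the finite group \<open>G\<close>, whose
    order bounds it.\<close>
  have "\<exists>\<Gamma>. (graph \<Gamma> \<and> (a, z) \<in> \<Gamma>) \<and>
      (\<forall>\<Delta>. graph \<Delta> \<and> (a, z) \<in> \<Delta> \<longrightarrow> card (fst ` \<Delta>) \<le> card (fst ` \<Gamma>))"
    using \<Gamma>0 sub fin
    by (intro ex_has_greatest_nat[of _ \<Gamma>0 _ "Suc (card (carrier G))"]) (auto simp: less_Suc_eq_le intro: card_mono)
  then obtain \<Gamma> where \<Gamma>: "graph \<Gamma>" "(a, z) \<in> \<Gamma>"
    and max: "\<And>\<Delta>. graph \<Delta> \<Longrightarrow> (a, z) \<in> \<Delta> \<Longrightarrow> card (fst ` \<Delta>) \<le> card (fst ` \<Gamma>)"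
    by blast
  have \<Gamma>_sub: "subgroup \<Gamma> (G \<times>\<times> Cstar)" using \<Gamma>(1) by (simp add: graph_def)
  have total: "x \<in> fst ` \<Gamma>" if x: "x \<in> carrier G" for x
  proof (rule ccontr)
    assume notin: "x \<notin> fst ` \<Gamma>"
    have "\<one>\<^bsub>G \<times>\<times> Cstar\<^esub> \<in> \<Gamma>" by (rule subgroup.one_closed[OF \<Gamma>_sub])
    then have "\<one> \<in> fst ` \<Gamma>" by force
    then have ex: "ord x > 0 \<and> x [^] ord x \<in> fst ` \<Gamma>"
      using x ord_ge_1[OF fin x] by simp
    \<comment> \<open>The extension step needs the first positive power of \<open>x\<close> in the
      domain; one exists because \<open>x [^] ord x\<close> is the unit.\<close>
    define n where "n = (LEAST n::nat. n > 0 \<and> x [^] n \<in> fst ` \<Gamma>)"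
    have n: "n > 0" "x [^] n \<in> fst ` \<Gamma>"
      using LeastI[of "\<lambda>n. n > 0 \<and> x [^] n \<in> fst ` \<Gamma>", OF ex] by (auto simp: n_def)
    have least: "x [^] k \<notin> fst ` \<Gamma>" if "0 < k" "k < n" for k :: nat
      using not_less_Least[of k "\<lambda>n. n > 0 \<and> x [^] n \<in> fst ` \<Gamma>"] that by (auto simp: n_def)
    obtain v where v: "(x [^] n, v) \<in> \<Gamma>" using n by force
    have "v \<noteq> 0" using subgroup.mem_carrier[OF \<Gamma>_sub v] by simp
    \<comment> \<open>Divisibility of the nonzero complex numbers: an \<open>n\<close>-th root of
      the value at \<open>x [^] n\<close> can serve as the value at \<open>x\<close>.\<close>
    obtain w where w: "w ^ n = v" using card_nth_roots[OF \<open>v \<noteq> 0\<close> n(1)] n(1) by (force simp: card_gt_0_iff)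
    have "w \<noteq> 0" using w \<open>v \<noteq> 0\<close> n(1) by (auto simp: power_0_left)
    then obtain \<Delta> where \<Delta>: "graph \<Delta>" "insert (x, w) \<Gamma> \<subseteq> \<Delta>"
      using extend[OF \<Gamma>(1) x _ n(1)] v w least by metis
    have "insert x (fst ` \<Gamma>) \<subseteq> fst ` \<Delta>" using \<Delta>(2) by force
    moreover have "finite (fst ` \<Delta>)" using sub[OF \<Delta>(1)] fin finite_subset by blast
    ultimately have "card (insert x (fst ` \<Gamma>)) \<le> card (fst ` \<Delta>)" by (simp add: card_mono)
    moreover have "finite (fst ` \<Gamma>)" using sub[OF \<Gamma>(1)] fin finite_subset by blast
    ultimately have "card (fst ` \<Gamma>) < card (fst ` \<Delta>)" using notin by simp
    then show False using max[OF \<Delta>(1)] \<Delta>(2) \<Gamma>(2) by force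
  qed
  \<comment> \<open>Two values at one argument would differ by an element of \<open>\<Gamma>\<close>
    over the unit, which is trivial.\<close>
  have unique: "v = w" if "(x, v) \<in> \<Gamma>" "(x, w) \<in> \<Gamma>" for x v w
  proof -
    have c: "x \<in> carrier G" "v \<noteq> 0" "w \<noteq> 0"
      using subgroup.mem_carrier[OF \<Gamma>_sub] that by auto
    have "(x, v) \<otimes>\<^bsub>G \<times>\<times> Cstar\<^esub> inv\<^bsub>G \<times>\<times> Cstar\<^esub> (x, w) \<in> \<Gamma>"
      using subgroup.m_closed[OF \<Gamma>_sub that(1) subgroup.m_inv_closed[OF \<Gamma>_sub that(2)]] .
    then have "(\<one>, v * inverse w) \<in> \<Gamma>"
      using c by (simp add: inv_DirProd is_group C.is_group)
    then have "v * inverse w = 1"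
      using \<Gamma>(1) by (auto simp: graph_def)
    then show ?thesis using c by (simp add: field_simps)
  qed
  define \<chi> where "\<chi> x = (THE w. (x, w) \<in> \<Gamma>)" for x
  have \<chi>: "\<chi> x = w" if "(x, w) \<in> \<Gamma>" for x w
    unfolding \<chi>_def using that unique by blast
  have "\<chi> \<in> hom G Cstar"
  proof (rule homI)
    fix x assume "x \<in> carrier G"
    then obtain v where v: "(x, v) \<in> \<Gamma>" using total by force
    then show "\<chi> x \<in> carrier Cstar"
      using subgroup.mem_carrier[OF \<Gamma>_sub v] \<chi> by simp
    fix y assume "y \<in> carrier G"
    then obtain w where w: "(y, w) \<in> \<Gamma>" using total by force
    have "(x \<otimes> y, v * w) \<in> \<Gamma>" using subgroup.m_closed[OF \<Gamma>_sub v w] by simp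
    then show "\<chi> (x \<otimes> y) = \<chi> x \<otimes>\<^bsub>Cstar\<^esub> \<chi> y" using v w \<chi> by simp
  qed
  then show ?thesis using \<chi>[OF \<Gamma>(2)] z(2) by auto
qed

section \<open>The group of characters and sums of their values\<close>

lemma dual_group_simps [simp]:
  "carrier (dual_group A) = hom A Cstar \<inter> extensional (carrier A)"
  "\<chi> \<otimes>\<^bsub>dual_group A\<^esub> \<psi> = (\<lambda>a \<in> carrier A. \<chi> a * \<psi> a)"
  "\<one>\<^bsub>dual_group A\<^esub> = (\<lambda>a \<in> carrier A. 1)"
  by (auto simp: dual_group_def)

lemma (in group) restrict_in_dual_group:
  assumes "\<And>a. a \<in> carrier G \<Longrightarrow> f a \<noteq> 0"
    and "\<And>a b. a \<in> carrier G \<Longrightarrow> b \<in> carrier G \<Longrightarrow> f (a \<otimes> b) = f a * f b"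
  shows "(\<lambda>a \<in> carrier G. f a) \<in> carrier (dual_group G)"
  using assms by (auto simp: hom_def)

lemma (in group) comm_group_dual_group: "comm_group (dual_group G)"
proof (rule comm_groupI)
  fix \<chi> assume \<chi>: "\<chi> \<in> carrier (dual_group G)"
  let ?i = "\<lambda>a \<in> carrier G. inverse (\<chi> a)"
  have "?i \<in> carrier (dual_group G)"
    using \<chi> by (intro restrict_in_dual_group) (auto simp: char_nonzero char_mult)
  moreover have "?i \<otimes>\<^bsub>dual_group G\<^esub> \<chi> = \<one>\<^bsub>dual_group G\<^esub>"
    using \<chi> by (auto simp: char_nonzero)
  ultimately show "\<exists>\<psi> \<in> carrier (dual_group G). \<psi> \<otimes>\<^bsub>dual_group G\<^esub> \<chi> = \<one>\<^bsub>dual_group G\<^esub>" by blast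
  show "\<one>\<^bsub>dual_group G\<^esub> \<otimes>\<^bsub>dual_group G\<^esub> \<chi> = \<chi>"
    using \<chi> by (auto simp: extensional_def)
next
  fix \<chi> \<psi> assume "\<chi> \<in> carrier (dual_group G)" "\<psi> \<in> carrier (dual_group G)"
  then have "(\<lambda>a \<in> carrier G. \<chi> a * \<psi> a) \<in> carrier (dual_group G)"
    by (intro restrict_in_dual_group) (auto simp: char_nonzero char_mult)
  then show "\<chi> \<otimes>\<^bsub>dual_group G\<^esub> \<psi> \<in> carrier (dual_group G)" by simp
next
  have "(\<lambda>a \<in> carrier G. 1) \<in> carrier (dual_group G)" by (intro restrict_in_dual_group) auto
  then show "\<one>\<^bsub>dual_group G\<^esub> \<in> carrier (dual_group G)" by simp
qed (auto simp: mult_ac)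

lemma (in group) inv_dual_group:
  assumes "\<chi> \<in> carrier (dual_group G)" "a \<in> carrier G"
  shows "(inv\<^bsub>dual_group G\<^esub> \<chi>) a = inverse (\<chi> a)"
proof -
  interpret D: comm_group "dual_group G" by (rule comm_group_dual_group)
  have "(inv\<^bsub>dual_group G\<^esub> \<chi> \<otimes>\<^bsub>dual_group G\<^esub> \<chi>) a = 1"
    using assms by (subst D.l_inv) auto
  then show ?thesis
    using assms by (simp add: field_simps char_nonzero)
qed

text \<open>The values of a character are roots of unity whose exponent is the group order, which
  leaves finitely many extensional functions.\<close>

lemma (in group) finite_dual_group:
  assumes "finite (carrier G)"
  shows "finite (carrier (dual_group G))"
proof (rule finite_subset)
  show "finite (carrier G \<rightarrow>\<^sub>E {z::complex. z ^ order G = 1})"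
    using assms by (intro finite_PiE finite_roots_unity) (auto simp: order_gt_0_iff_finite Suc_le_eq)
  show "carrier (dual_group G) \<subseteq> carrier G \<rightarrow>\<^sub>E {z. z ^ order G = 1}"
  proof
    fix \<chi> assume "\<chi> \<in> carrier (dual_group G)"
    then have \<chi>: "\<chi> \<in> hom G Cstar" "\<chi> \<in> extensional (carrier G)" by auto
    interpret \<chi>: group_hom G Cstar \<chi>
      using \<chi> comm_group_Cstar by (simp add: group_hom_def group_hom_axioms_def is_group comm_group_def)
    have "\<chi> a ^ order G = 1" if "a \<in> carrier G" for a
      using \<chi>.hom_nat_pow[OF that, of "order G"] char_one[OF \<chi>(1)] that
      by (simp add: pow_order_eq_1)
    then show "\<chi> \<in> carrier G \<rightarrow>\<^sub>E {z. z ^ order G = 1}" using \<chi> by (auto simp: PiE_def)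
  qed
qed

lemma (in group) sum_char:
  assumes "\<chi> \<in> carrier (dual_group G)"
  shows "(\<Sum>a \<in> carrier G. \<chi> a) = (if \<chi> = \<one>\<^bsub>dual_group G\<^esub> then of_nat (order G) else 0)"
proof (cases "\<forall>a \<in> carrier G. \<chi> a = 1")
  case True
  then have "\<chi> = \<one>\<^bsub>dual_group G\<^esub>" using assms by (auto simp: extensional_def)
  then show ?thesis by (simp add: order_def)
next
  case False
  then have "\<chi> \<noteq> \<one>\<^bsub>dual_group G\<^esub>" by auto
  then show ?thesis using False sum_char_eq_0 assms by auto
qed

section \<open>Orthogonality relations for characters\<close>

context comm_group
begin

text \<open>Evaluation at \<open>a\<close> is a character of the dual group; for \<open>a\<close>
  other than the unit it is nontrivial, because some character does not send \<open>a\<close> to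
  1.\<close>

lemma sum_dual_group:
  assumes "finite (carrier G)" "a \<in> carrier G"
  shows "(\<Sum>\<chi> \<in> carrier (dual_group G). \<chi> a) =
    (if a = \<one> then of_nat (order (dual_group G)) else 0)"
proof (cases "a = \<one>")
  case True
  then have "(\<Sum>\<chi> \<in> carrier (dual_group G). \<chi> a) = (\<Sum>\<chi> \<in> carrier (dual_group G). 1)"
    by (intro sum.cong) (auto simp: char_one)
  then show ?thesis using True by (simp add: order_def)
next
  case False
  interpret D: comm_group "dual_group G" by (rule comm_group_dual_group)
  obtain \<chi> where \<chi>: "\<chi> \<in> hom G Cstar" "\<chi> a \<noteq> 1"
    using exists_char_neq_1[OF assms False] by blast
  have "(\<lambda>x \<in> carrier G. \<chi> x) \<in> carrier (dual_group G)"
    using \<chi> by (intro restrict_in_dual_group) (auto simp: char_nonzero char_mult)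
  moreover have "(\<lambda>\<chi>. \<chi> a) \<in> hom (dual_group G) Cstar"
    using assms by (intro homI) (auto simp: char_nonzero)
  ultimately have "(\<Sum>\<chi> \<in> carrier (dual_group G). \<chi> a) = 0"
    using \<chi>(2) assms(2) by (intro D.sum_char_eq_0[of "\<lambda>\<chi>. \<chi> a" "\<lambda>x \<in> carrier G. \<chi> x"]) simp_all
  then show ?thesis using False by simp
qed

text \<open>The sum of \<open>\<chi> a\<close> over all pairs is evaluated twice: only the unit
  contributes when characters are summed first, only the trivial character when elements
  are.\<close>

lemma order_dual_group:
  assumes "finite (carrier G)"
  shows "order (dual_group G) = order G"
proof -
  interpret D: comm_group "dual_group G" by (rule comm_group_dual_group)
  have fin: "finite (carrier (dual_group G))" by (rule finite_dual_group[OF assms])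
  have "(of_nat (order (dual_group G)) :: complex) =
      (\<Sum>a \<in> carrier G. if a = \<one> then of_nat (order (dual_group G)) else 0)"
    using assms by simp
  also have "\<dots> = (\<Sum>a \<in> carrier G. \<Sum>\<chi> \<in> carrier (dual_group G). \<chi> a)"
    by (intro sum.cong refl) (simp only: sum_dual_group[OF assms])
  also have "\<dots> = (\<Sum>\<chi> \<in> carrier (dual_group G). \<Sum>a \<in> carrier G. \<chi> a)" by (rule sum.swap)
  also have "\<dots> = (\<Sum>\<chi> \<in> carrier (dual_group G).
      if \<chi> = \<one>\<^bsub>dual_group G\<^esub> then of_nat (order G) else 0)"
    by (intro sum.cong refl) (simp only: sum_char)
  also have "\<dots> = of_nat (order G)"
    using fin D.one_closed by (simp only: sum.delta if_True)
  finally show ?thesis by simp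
qed

text \<open>The quotient of two characters is a character, and its sum detects whether it is
  trivial.\<close>

lemma row_orthogonality:
  assumes "finite (carrier G)" and \<chi>: "\<chi> \<in> carrier (dual_group G)" "\<psi> \<in> carrier (dual_group G)"
  shows "(\<Sum>a \<in> carrier G. \<chi> a / \<psi> a) = (if \<chi> = \<psi> then of_nat (order G) else 0)"
proof -
  interpret D: comm_group "dual_group G" by (rule comm_group_dual_group)
  let ?\<theta> = "\<chi> \<otimes>\<^bsub>dual_group G\<^esub> inv\<^bsub>dual_group G\<^esub> \<psi>"
  have "?\<theta> \<in> carrier (dual_group G)" using \<chi> by (intro D.m_closed D.inv_closed)
  then have "(\<Sum>a \<in> carrier G. ?\<theta> a) =
      (if ?\<theta> = \<one>\<^bsub>dual_group G\<^esub> then of_nat (order G) else 0)"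
    by (rule sum_char)
  moreover have "(\<Sum>a \<in> carrier G. ?\<theta> a) = (\<Sum>a \<in> carrier G. \<chi> a / \<psi> a)"
    using \<chi> by (intro sum.cong) (auto simp: inv_dual_group divide_inverse)
  moreover have "?\<theta> = \<one>\<^bsub>dual_group G\<^esub> \<longleftrightarrow> \<chi> = \<psi>"
    using D.inv_solve_right[OF D.one_closed \<chi>] by (simp only: D.l_one[OF \<chi>(2)] eq_commute)
  ultimately show ?thesis by simp
qed

text \<open>Each term is \<open>\<chi> (a \<otimes> inv b)\<close>, so the sum over characters
  detects \<open>a = b\<close>; \<open>order_dual_group\<close> turns the resulting constant into
  \<open>order G\<close>.\<close>

lemma column_orthogonality:
  assumes "finite (carrier G)" "a \<in> carrier G" "b \<in> carrier G"
  shows "(\<Sum>\<chi> \<in> carrier (dual_group G). \<chi> a / \<chi> b) = (if a = b then of_nat (order G) else 0)"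
proof -
  have "(\<Sum>\<chi> \<in> carrier (dual_group G). \<chi> a / \<chi> b) =
      (\<Sum>\<chi> \<in> carrier (dual_group G). \<chi> (a \<otimes> inv b))"
    using assms by (intro sum.cong) (auto simp: char_mult char_inv divide_inverse)
  also have "\<dots> = (if a \<otimes> inv b = \<one> then of_nat (order G) else 0)"
    using assms order_dual_group by (subst sum_dual_group) auto
  also have "a \<otimes> inv b = \<one> \<longleftrightarrow> a = b"
    using assms inv_solve_right[of \<one> a b] by auto
  finally show ?thesis .
qed

end

subsection \<open>Monomial projective representations\<close>

text \<open>
  The matrix of \<open>x\<close>, with rows and columns indexed by \<open>Q\<close>, has the entry \<open>t x m\<close> in row \<open>m\<close> and
  column \<open>m \<otimes> p x\<close> and vanishes elsewhere. The two orthogonality relations make these matrices a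
  basis of the full matrix algebra.
\<close>

locale monomial_rep = G: group G + Q: group Q
  for G :: "('g, 'd) monoid_scheme" (structure) and Q :: "('q, 'c) monoid_scheme" (structure) +
  fixes p :: "'g \<Rightarrow> 'q" and t :: "'g \<Rightarrow> 'q \<Rightarrow> complex" and c :: "'g list \<Rightarrow> complex"
  assumes finite_G: "finite (carrier G)" and finite_Q: "finite (carrier Q)"
    and p_hom: "p \<in> hom G Q"
    and t_nonzero: "x \<in> carrier G \<Longrightarrow> m \<in> carrier Q \<Longrightarrow> t x m \<noteq> 0"
    and t_mult: "x \<in> carrier G \<Longrightarrow> y \<in> carrier G \<Longrightarrow> m \<in> carrier Q \<Longrightarrow>
      t x m * t y (m \<otimes>\<^bsub>Q\<^esub> p x) = c [x, y] * t (x \<otimes>\<^bsub>G\<^esub> y) m"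
    and col_orth: "x \<in> carrier G \<Longrightarrow> y \<in> carrier G \<Longrightarrow> p x = p y \<Longrightarrow>
      (\<Sum>m \<in> carrier Q. t x m / t y m) = (if x = y then of_nat (order Q) else 0)"
    and row_orth: "g \<in> carrier Q \<Longrightarrow> m \<in> carrier Q \<Longrightarrow> l \<in> carrier Q \<Longrightarrow>
      (\<Sum>x | x \<in> carrier G \<and> p x = g. t x m / t x l) = (if m = l then of_nat (order Q) else 0)"
begin

lemma p_closed [simp]: "x \<in> carrier G \<Longrightarrow> p x \<in> carrier Q"
  using p_hom by (auto simp: hom_def)

lemma p_mult: "x \<in> carrier G \<Longrightarrow> y \<in> carrier G \<Longrightarrow> p (x \<otimes>\<^bsub>G\<^esub> y) = p x \<otimes>\<^bsub>Q\<^esub> p y"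
  using p_hom by (auto simp: hom_def)

lemma order_Q_nonzero: "of_nat (order Q) \<noteq> (0::complex)"
  using finite_Q Q.order_gt_0_iff_finite by simp

text \<open>For \<open>m\<close> and \<open>l\<close> both the unit, every term of row orthogonality
  is 1, so the relation counts a fibre of \<open>p\<close>: each of the \<open>order Q\<close>
  fibres has \<open>order Q\<close> elements.\<close>

lemma order_G: "order G = (order Q)\<^sup>2"
proof -
  have "card {x \<in> carrier G. p x = g} = order Q" if g: "g \<in> carrier Q" for g
  proof -
    have "of_nat (card {x \<in> carrier G. p x = g}) =
        (\<Sum>x | x \<in> carrier G \<and> p x = g. t x \<one>\<^bsub>Q\<^esub> / t x \<one>\<^bsub>Q\<^esub>)"
      by (simp add: t_nonzero)
    also have "\<dots> = of_nat (order Q)"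
      using row_orth[OF g Q.one_closed Q.one_closed] by simp
    finally show ?thesis using of_nat_eq_iff by blast
  qed
  then have "(\<Sum>g \<in> carrier Q. card {x \<in> carrier G. p x = g}) = order Q * order Q"
    by (simp add: order_def)
  moreover have "(\<Sum>g \<in> carrier Q. card {x \<in> carrier G. p x = g}) = card (carrier G)"
    using sum.group[OF finite_G finite_Q, of p "\<lambda>_. 1::nat"] by (simp add: image_subset_iff)
  ultimately show ?thesis by (simp add: order_def power2_eq_square)
qed

definition entry :: "'g \<Rightarrow> 'q \<Rightarrow> 'q \<Rightarrow> complex" where
  "entry x m k = (if k = m \<otimes>\<^bsub>Q\<^esub> p x then t x m else 0)"

text \<open>This is the linear extension to the twisted group algebra. Matrices stay functions on
  pairs from \<open>Q\<close>, so that an enumeration of \<open>Q\<close> is chosen only for the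
  final isomorphism.\<close>

definition lin_entry :: "('g \<Rightarrow> complex) \<Rightarrow> 'q \<Rightarrow> 'q \<Rightarrow> complex" where
  "lin_entry u m k = (\<Sum>x \<in> carrier G. u x * entry x m k)"

text \<open>Row \<open>m\<close> of the first matrix is supported in one column, so a single
  \<open>l\<close> survives and \<open>t_mult\<close> applies.\<close>

lemma entry_mult:
  assumes "x \<in> carrier G" "y \<in> carrier G" "m \<in> carrier Q"
  shows "(\<Sum>l \<in> carrier Q. entry x m l * entry y l k) = c [x, y] * entry (x \<otimes>\<^bsub>G\<^esub> y) m k"
proof -
  have "(\<Sum>l \<in> carrier Q. entry x m l * entry y l k) =
      (\<Sum>l \<in> carrier Q. if l = m \<otimes>\<^bsub>Q\<^esub> p x then t x m * entry y l k else 0)"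
    by (intro sum.cong) (auto simp: entry_def)
  also have "\<dots> = t x m * entry y (m \<otimes>\<^bsub>Q\<^esub> p x) k"
    using assms finite_Q by simp
  also have "\<dots> = c [x, y] * entry (x \<otimes>\<^bsub>G\<^esub> y) m k"
    using assms t_mult[of x y m] by (simp add: entry_def p_mult Q.m_assoc)
  finally show ?thesis .
qed

abbreviation (input) \<A> where "\<A> \<equiv> twisted_group_algebra G c"

lemma lin_entry_mult:
  assumes "m \<in> carrier Q"
  shows "lin_entry (u \<otimes>\<^bsub>\<A>\<^esub> v) m k = (\<Sum>l \<in> carrier Q. lin_entry u m l * lin_entry v l k)"
proof -
  let ?h = "\<lambda>(x, y). c [x, y] * u x * v y * entry (x \<otimes>\<^bsub>G\<^esub> y) m k"
  let ?S = "\<lambda>z. {s \<in> carrier G \<times> carrier G. fst s \<otimes>\<^bsub>G\<^esub> snd s = z}"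
  have "lin_entry (u \<otimes>\<^bsub>\<A>\<^esub> v) m k = (\<Sum>z \<in> carrier G. \<Sum>s \<in> ?S z. ?h s)"
    unfolding lin_entry_def
  proof (intro sum.cong refl)
    fix z assume "z \<in> carrier G"
    have S: "?S z = {(x, y) \<in> carrier G \<times> carrier G. x \<otimes>\<^bsub>G\<^esub> y = z}" by auto
    show "(u \<otimes>\<^bsub>\<A>\<^esub> v) z * entry z m k = (\<Sum>s \<in> ?S z. ?h s)"
      using \<open>z \<in> carrier G\<close>
      by (auto simp: S twisted_group_algebra_def sum_distrib_right intro!: sum.cong)
  qed
  \<comment> \<open>The sets \<open>?S z\<close> partition all pairs according to their
    product.\<close>
  also have "\<dots> = (\<Sum>s \<in> carrier G \<times> carrier G. ?h s)"
    using finite_G by (intro sum.group) auto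
  also have "\<dots> = (\<Sum>x \<in> carrier G. \<Sum>y \<in> carrier G. u x * v y * (c [x, y] * entry (x \<otimes>\<^bsub>G\<^esub> y) m k))"
    by (subst sum.cartesian_product) (auto intro!: sum.cong)
  also have "\<dots> = (\<Sum>x \<in> carrier G. \<Sum>y \<in> carrier G. \<Sum>l \<in> carrier Q.
      (u x * entry x m l) * (v y * entry y l k))"
    using assms by (auto simp: sum_distrib_left mult_ac simp flip: entry_mult intro!: sum.cong)
  also have "\<dots> = (\<Sum>x \<in> carrier G. \<Sum>l \<in> carrier Q. \<Sum>y \<in> carrier G.
      (u x * entry x m l) * (v y * entry y l k))"
    by (intro sum.cong refl sum.swap)
  also have "\<dots> = (\<Sum>l \<in> carrier Q. \<Sum>x \<in> carrier G. \<Sum>y \<in> carrier G.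
      (u x * entry x m l) * (v y * entry y l k))"
    by (rule sum.swap)
  also have "\<dots> = (\<Sum>l \<in> carrier Q. lin_entry u m l * lin_entry v l k)"
    by (simp add: lin_entry_def sum_product)
  finally show ?thesis .
qed

lemma lin_entry_one:
  assumes "m \<in> carrier Q"
  shows "lin_entry \<one>\<^bsub>\<A>\<^esub> m k = (if m = k then 1 else 0)"
proof -
  have p1: "p \<one>\<^bsub>G\<^esub> = \<one>\<^bsub>Q\<^esub>" using hom_one[OF p_hom] G.is_group Q.is_group by blast
  \<comment> \<open>Multiplying the unit by itself forces \<open>t\<close> at the unit to be the
    constant \<open>c [\<one>, \<one>]\<close>, which the scalar in the unit of the algebra
    inverts.\<close>
  have t1: "t \<one>\<^bsub>G\<^esub> m = c [\<one>\<^bsub>G\<^esub>, \<one>\<^bsub>G\<^esub>]"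
    using t_mult[of "\<one>\<^bsub>G\<^esub>" "\<one>\<^bsub>G\<^esub>" m] t_nonzero[of "\<one>\<^bsub>G\<^esub>" m] assms by (simp add: p1)
  have "lin_entry \<one>\<^bsub>\<A>\<^esub> m k = (\<Sum>x \<in> carrier G.
      if x = \<one>\<^bsub>G\<^esub> then inverse (c [\<one>\<^bsub>G\<^esub>, \<one>\<^bsub>G\<^esub>]) * entry x m k else 0)"
    unfolding lin_entry_def by (intro sum.cong) (auto simp: twisted_group_algebra_def)
  also have "\<dots> = (if m = k then 1 else 0)"
    using finite_G assms t_nonzero[of "\<one>\<^bsub>G\<^esub>" m] t1 by (auto simp: entry_def p1)
  finally show ?thesis .
qed

text \<open>Fourier inversion: the entries on the support of the matrix of \<open>x\<close> are
  divided by those of that matrix and averaged over all rows.\<close>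

definition coefficients :: "('q \<Rightarrow> 'q \<Rightarrow> complex) \<Rightarrow> 'g \<Rightarrow> complex" where
  "coefficients N = (\<lambda>x \<in> carrier G.
     (\<Sum>m \<in> carrier Q. N m (m \<otimes>\<^bsub>Q\<^esub> p x) / t x m) / of_nat (order Q))"

text \<open>Elements with different images under \<open>p\<close> have matrices of disjoint support;
  among those with the same image, column orthogonality isolates the coefficient of
  \<open>x\<close>.\<close>

lemma coefficients_lin_entry:
  assumes "u \<in> extensional (carrier G)"
  shows "coefficients (lin_entry u) = u"
proof (rule extensionalityI[of _ "carrier G"])
  fix x assume x: "x \<in> carrier G"
  have "(\<Sum>m \<in> carrier Q. lin_entry u m (m \<otimes>\<^bsub>Q\<^esub> p x) / t x m) =
      (\<Sum>m \<in> carrier Q. \<Sum>y \<in> carrier G. if p y = p x then u y * (t y m / t x m) else 0)"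
    using x by (auto simp: lin_entry_def entry_def sum_divide_distrib intro!: sum.cong)
  also have "\<dots> = (\<Sum>y \<in> carrier G. if p y = p x then u y * (\<Sum>m \<in> carrier Q. t y m / t x m) else 0)"
    by (subst sum.swap) (auto simp: sum_distrib_left intro!: sum.cong)
  also have "\<dots> = (\<Sum>y \<in> carrier G. if y = x then u y * of_nat (order Q) else 0)"
  proof (intro sum.cong refl)
    fix y assume y: "y \<in> carrier G"
    show "(if p y = p x then u y * (\<Sum>m \<in> carrier Q. t y m / t x m) else 0) =
        (if y = x then u y * of_nat (order Q) else 0)"
    proof (cases "p y = p x")
      case True
      then show ?thesis
        by (simp only: col_orth[OF y x True] if_True) (simp split: if_split)
    qed auto
  qed
  also have "\<dots> = u x * of_nat (order Q)" using x finite_G by simp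
  finally show "coefficients (lin_entry u) x = u x"
    using x order_Q_nonzero by (simp add: coefficients_def)
qed (use assms in \<open>auto simp: coefficients_def\<close>)

text \<open>Within one fibre of \<open>p\<close>, row orthogonality removes every row other than
  \<open>m\<close>. This is the surjectivity half of the isomorphism.\<close>

lemma lin_entry_coefficients:
  assumes m: "m \<in> carrier Q" and k: "k \<in> carrier Q"
  shows "lin_entry (coefficients N) m k = N m k"
proof -
  \<comment> \<open>Only elements over this \<open>g\<close> have a nonzero entry in row
    \<open>m\<close> and column \<open>k\<close>.\<close>
  define g where "g = inv\<^bsub>Q\<^esub> m \<otimes>\<^bsub>Q\<^esub> k"
  have g: "g \<in> carrier Q" "m \<otimes>\<^bsub>Q\<^esub> g = k"
    using m k by (auto simp: g_def simp flip: Q.m_assoc)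
  have iff: "k = m \<otimes>\<^bsub>Q\<^esub> p x \<longleftrightarrow> p x = g" if "x \<in> carrier G" for x
    using g m that by (metis Q.l_cancel p_closed)
  have "lin_entry (coefficients N) m k =
      (\<Sum>x | x \<in> carrier G \<and> p x = g. coefficients N x * t x m)"
    using finite_G unfolding lin_entry_def
    by (intro sum.mono_neutral_cong_right) (auto simp: entry_def iff)
  also have "\<dots> = (\<Sum>x | x \<in> carrier G \<and> p x = g.
      \<Sum>l \<in> carrier Q. N l (l \<otimes>\<^bsub>Q\<^esub> g) / of_nat (order Q) * (t x m / t x l))"
    by (auto simp: coefficients_def sum_distrib_left sum_divide_distrib mult_ac intro!: sum.cong)
  also have "\<dots> = (\<Sum>l \<in> carrier Q. N l (l \<otimes>\<^bsub>Q\<^esub> g) / of_nat (order Q) *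
      (\<Sum>x | x \<in> carrier G \<and> p x = g. t x m / t x l))"
    by (subst sum.swap) (simp add: sum_distrib_left)
  also have "\<dots> = (\<Sum>l \<in> carrier Q. if l = m then N l (l \<otimes>\<^bsub>Q\<^esub> g) else 0)"
    using g m order_Q_nonzero by (intro sum.cong) (auto simp: row_orth)
  also have "\<dots> = N m k" using m g finite_Q by simp
  finally show ?thesis .
qed

theorem twisted_group_algebra_isomorphic_mat:
  "algebra_isomorphic \<A> (module_mat TYPE(complex) (order Q) (order Q))"
proof -
  let ?n = "order Q"
  let ?M = "module_mat TYPE(complex) ?n ?n"
  obtain e where e: "bij_betw e {0..<?n} (carrier Q)"
    using ex_bij_betw_nat_finite[OF finite_Q] by (auto simp: order_def)
  have eQ: "e i \<in> carrier Q" if "i < ?n" for i using bij_betwE[OF e] that by auto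
  have e_eq: "e i = e j \<longleftrightarrow> i = j" if "i < ?n" "j < ?n" for i j
    using that bij_betw_imp_inj_on[OF e] by (auto dest: inj_onD)
  \<comment> \<open>The inverse enumeration, through which \<open>coefficients\<close> reads a
    matrix in the inverse of \<open>h\<close>.\<close>
  define e' where "e' = inv_into {0..<?n} e"
  have e': "e' (e i) = i" if "i < ?n" for i
    using that bij_betw_inv_into_left[OF e] by (simp add: e'_def)
  define h where "h u = mat ?n ?n (\<lambda>(i, j). lin_entry u (e i) (e j))" for u
  have "h \<in> Ring.ring_hom \<A> ?M"
  proof (rule ring_hom_memI)
    fix u v
    show "h (u \<otimes>\<^bsub>\<A>\<^esub> v) = h u \<otimes>\<^bsub>?M\<^esub> h v"
    proof (rule eq_matI)
      fix i j assume ij: "i < dim_row (h u \<otimes>\<^bsub>?M\<^esub> h v)" "j < dim_col (h u \<otimes>\<^bsub>?M\<^esub> h v)"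
      then have "h (u \<otimes>\<^bsub>\<A>\<^esub> v) $$ (i, j) =
          (\<Sum>l \<in> carrier Q. lin_entry u (e i) l * lin_entry v l (e j))"
        by (simp add: h_def module_mat_simps lin_entry_mult eQ)
      also have "\<dots> = (\<Sum>l \<in> {0..<?n}. lin_entry u (e i) (e l) * lin_entry v (e l) (e j))"
        by (rule sum.reindex_bij_betw[OF e, symmetric])
      also have "\<dots> = (h u \<otimes>\<^bsub>?M\<^esub> h v) $$ (i, j)"
        using ij by (simp add: h_def module_mat_simps scalar_prod_def)
      finally show "h (u \<otimes>\<^bsub>\<A>\<^esub> v) $$ (i, j) = (h u \<otimes>\<^bsub>?M\<^esub> h v) $$ (i, j)" .
    qed (simp_all add: h_def module_mat_simps)
    show "h (u \<oplus>\<^bsub>\<A>\<^esub> v) = h u \<oplus>\<^bsub>?M\<^esub> h v"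
      by (rule eq_matI) (auto simp: h_def module_mat_simps lin_entry_def twisted_group_algebra_def
          distrib_right sum.distrib)
    show "h u \<in> carrier ?M" by (simp add: h_def module_mat_simps)
  next
    show "h \<one>\<^bsub>\<A>\<^esub> = \<one>\<^bsub>?M\<^esub>"
      by (rule eq_matI) (auto simp: h_def module_mat_simps lin_entry_one eQ e_eq)
  qed
  moreover have "bij_betw h (carrier \<A>) (carrier ?M)"
  proof (rule bij_betw_byWitness[where f' = "\<lambda>M. coefficients (\<lambda>m k. M $$ (e' m, e' k))"])
    show "\<forall>u \<in> carrier \<A>. coefficients (\<lambda>m k. h u $$ (e' m, e' k)) = u"
    proof
      fix u assume u: "u \<in> carrier \<A>"
      have "e' m < ?n \<and> e (e' m) = m" if "m \<in> carrier Q" for m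
        using that e bij_betw_inv_into_right[OF e] bij_betwE[OF bij_betw_inv_into[OF e]]
        by (auto simp: e'_def)
      then have "coefficients (\<lambda>m k. h u $$ (e' m, e' k)) = coefficients (lin_entry u)"
        unfolding coefficients_def by (intro restrict_ext) (simp add: h_def)
      then show "coefficients (\<lambda>m k. h u $$ (e' m, e' k)) = u"
        using u coefficients_lin_entry by (simp add: twisted_group_algebra_def)
    qed
    show "\<forall>M \<in> carrier ?M. h (coefficients (\<lambda>m k. M $$ (e' m, e' k))) = M"
      by (auto simp: h_def module_mat_simps lin_entry_coefficients eQ e' intro!: eq_matI)
  qed (auto simp: h_def module_mat_simps coefficients_def twisted_group_algebra_def)
  moreover have "h (a \<odot>\<^bsub>\<A>\<^esub> u) = a \<odot>\<^bsub>?M\<^esub> h u" for a u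
    by (rule eq_matI) (auto simp: h_def module_mat_simps lin_entry_def twisted_group_algebra_def
        sum_distrib_left mult.assoc)
  ultimately show ?thesis
    unfolding algebra_isomorphic_def ring_iso_def by blast
qed

section \<open>The 2-cocycle of the projective representation\<close>

lemma c_nonzero:
  assumes "x \<in> carrier G" "y \<in> carrier G"
  shows "c [x, y] \<noteq> 0"
  using t_mult[OF assms Q.one_closed] t_nonzero assms by auto

text \<open>Both sides come from the two bracketings of a product of three monomial matrices. Their
  entries in the row of the unit are compared, and the common factor \<open>t\<close> at the triple
  product is nonzero.\<close>

lemma c_cocycle:
  assumes "x \<in> carrier G" "y \<in> carrier G" "z \<in> carrier G"
  shows "c [y, z] * c [x, y \<otimes>\<^bsub>G\<^esub> z] = c [x, y] * c [x \<otimes>\<^bsub>G\<^esub> y, z]"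
proof -
  let ?l = "\<one>\<^bsub>Q\<^esub> \<otimes>\<^bsub>Q\<^esub> p x"
  have "c [x, y] * c [x \<otimes>\<^bsub>G\<^esub> y, z] * t (x \<otimes>\<^bsub>G\<^esub> y \<otimes>\<^bsub>G\<^esub> z) \<one>\<^bsub>Q\<^esub> =
      c [x, y] * t (x \<otimes>\<^bsub>G\<^esub> y) \<one>\<^bsub>Q\<^esub> * t z (\<one>\<^bsub>Q\<^esub> \<otimes>\<^bsub>Q\<^esub> p (x \<otimes>\<^bsub>G\<^esub> y))"
    using t_mult[of "x \<otimes>\<^bsub>G\<^esub> y" z "\<one>\<^bsub>Q\<^esub>"] assms by (simp add: mult.assoc)
  also have "\<dots> = t x \<one>\<^bsub>Q\<^esub> * t y ?l * t z (?l \<otimes>\<^bsub>Q\<^esub> p y)"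
    using t_mult[of x y "\<one>\<^bsub>Q\<^esub>"] assms by (simp add: p_mult)
  also have "\<dots> = c [y, z] * (t x \<one>\<^bsub>Q\<^esub> * t (y \<otimes>\<^bsub>G\<^esub> z) ?l)"
    using t_mult[of y z ?l] assms by (simp add: mult_ac)
  also have "\<dots> = c [y, z] * c [x, y \<otimes>\<^bsub>G\<^esub> z] * t (x \<otimes>\<^bsub>G\<^esub> y \<otimes>\<^bsub>G\<^esub> z) \<one>\<^bsub>Q\<^esub>"
    using t_mult[of x "y \<otimes>\<^bsub>G\<^esub> z" "\<one>\<^bsub>Q\<^esub>"] assms by (simp add: G.m_assoc)
  finally show ?thesis
    using t_nonzero[of "x \<otimes>\<^bsub>G\<^esub> y \<otimes>\<^bsub>G\<^esub> z" "\<one>\<^bsub>Q\<^esub>"] assms by simp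
qed

theorem central_type_G:
  assumes "c \<in> carrier (cochains G Cstar 2)"
  shows "central_type G"
proof -
  have "coboundary G Cstar trivial_action 2 c gs = 1" if gs: "gs \<in> tuples G 3" for gs
  proof -
    obtain x y z where xyz: "gs = [x, y, z]" "x \<in> carrier G" "y \<in> carrier G" "z \<in> carrier G"
      using gs by (auto simp: tuples_def numeral_3_eq_3 length_Suc_conv)
    have "coboundary G Cstar trivial_action 2 c [x, y, z] = 1"
      using xyz c_nonzero c_cocycle[of x y z]
      by (subst coboundary_2[OF comm_group_Cstar G.is_group])
        (auto simp: trivial_action_def field_simps)
    then show ?thesis by (simp add: xyz)
  qed
  \<comment> \<open>The values on triples settle equality with the unit cochain only together with
    extensionality.\<close>
  moreover have "coboundary G Cstar trivial_action 2 c \<in> extensional (tuples G 3)"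
    by (simp add: coboundary_def numeral_3_eq_3 numeral_2_eq_2)
  ultimately have "coboundary G Cstar trivial_action 2 c = \<one>\<^bsub>cochains G Cstar (Suc 2)\<^esub>"
    by (auto simp: cochains_def extensional_def)
  then have "c \<in> cocycles G Cstar trivial_action 2"
    using assms by (simp add: cocycles_def)
  then have "cohomology_class G Cstar trivial_action 2 c \<in>
      carrier (cohomology G Cstar trivial_action 2)"
    by (simp add: carrier_cohomology)
  moreover have "c \<in> cohomology_class G Cstar trivial_action 2 c"
    using cochain_in_cohomology_class[OF comm_group_Cstar G.is_group, of trivial_action c 1] assms
    by (simp add: trivial_action_def numeral_2_eq_2)
  ultimately show ?thesis
    unfolding central_type_def nondegenerate_class_def
    using G.is_group finite_G order_G twisted_group_algebra_isomorphic_mat by metis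
qed

end

subsection \<open>Bijective classes and extensions\<close>

locale group_module = A: comm_group A + Q: group Q
  for A :: "('a, 'b) monoid_scheme" (structure) and Q :: "('q, 'c) monoid_scheme" (structure) +
  fixes \<phi> :: "'q \<Rightarrow> 'a \<Rightarrow> 'a"
  assumes action_hom: "\<phi> \<in> hom Q (AutoGroup A)"
begin

lemma action_closed [simp]: "g \<in> carrier Q \<Longrightarrow> a \<in> carrier A \<Longrightarrow> \<phi> g a \<in> carrier A"
  using action_hom by (auto simp: hom_def AutoGroup_def auto_def)

lemma action_mult:
  "g \<in> carrier Q \<Longrightarrow> a \<in> carrier A \<Longrightarrow> b \<in> carrier A \<Longrightarrow>
    \<phi> g (a \<otimes>\<^bsub>A\<^esub> b) = \<phi> g a \<otimes>\<^bsub>A\<^esub> \<phi> g b"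
  using action_hom by (auto simp: hom_def AutoGroup_def auto_def)

lemma action_comp:
  assumes "g \<in> carrier Q" "h \<in> carrier Q" "a \<in> carrier A"
  shows "\<phi> (g \<otimes>\<^bsub>Q\<^esub> h) a = \<phi> g (\<phi> h a)"
proof -
  have "\<phi> (g \<otimes>\<^bsub>Q\<^esub> h) = \<phi> g \<otimes>\<^bsub>AutoGroup A\<^esub> \<phi> h"
    using assms action_hom by (simp add: hom_def)
  moreover have "\<phi> g \<in> Bij (carrier A)" "\<phi> h \<in> Bij (carrier A)"
    using assms action_hom by (auto simp: hom_def AutoGroup_def auto_def)
  ultimately show ?thesis
    using assms by (simp add: AutoGroup_def BijGroup_def compose_def)
qed

lemma action_one [simp]:
  assumes "a \<in> carrier A"
  shows "\<phi> \<one>\<^bsub>Q\<^esub> a = a"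
proof -
  have "\<phi> \<one>\<^bsub>Q\<^esub> = \<one>\<^bsub>AutoGroup A\<^esub>"
    using hom_one[OF action_hom] Q.is_group A.AutoGroup by blast
  then show ?thesis using assms by (simp add: AutoGroup_def BijGroup_def)
qed

lemma action_inv [simp]:
  assumes "g \<in> carrier Q" "a \<in> carrier A"
  shows "\<phi> (inv\<^bsub>Q\<^esub> g) (\<phi> g a) = a"
  using assms action_comp[of "inv\<^bsub>Q\<^esub> g" g a] by simp

lemma action_fixes_one [simp]: "g \<in> carrier Q \<Longrightarrow> \<phi> g \<one>\<^bsub>A\<^esub> = \<one>\<^bsub>A\<^esub>"
  using action_mult[of g "\<one>\<^bsub>A\<^esub>" "\<one>\<^bsub>A\<^esub>"] A.r_cancel_one[of "\<phi> g \<one>\<^bsub>A\<^esub>" "\<phi> g \<one>\<^bsub>A\<^esub>"] by simp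

lemma dual_action_closed:
  assumes "g \<in> carrier Q" "\<chi> \<in> carrier (dual_group A)"
  shows "dual_action Q A \<phi> g \<chi> \<in> carrier (dual_group A)"
  unfolding dual_action_def using assms
  by (intro A.restrict_in_dual_group) (auto simp: action_mult A.char_mult A.char_nonzero)

text \<open>A representative is a cocycle \<open>f\<close> times the coboundary of a 0-cochain
  \<open>b\<close>, whose contributions telescope. The rule is proved for every member of
  \<open>P\<close>, because bijectivity holds for an unspecified one.\<close>

lemma crossed_hom_of_class:
  assumes P: "P \<in> carrier (cohomology Q (dual_group A) (dual_action Q A \<phi>) 1)" and \<pi>: "\<pi> \<in> P"
    and g: "g \<in> carrier Q"
  shows "\<pi> [g] \<in> carrier (dual_group A)"
    and "h \<in> carrier Q \<Longrightarrow> a \<in> carrier A \<Longrightarrow>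
      \<pi> [g \<otimes>\<^bsub>Q\<^esub> h] a = \<pi> [g] a * \<pi> [h] (\<phi> (inv\<^bsub>Q\<^esub> g) a)"
proof -
  let ?D = "dual_group A" and ?\<delta> = "dual_action Q A \<phi>"
  interpret D: comm_group ?D by (rule A.comm_group_dual_group)
  obtain f where f: "f \<in> cocycles Q ?D ?\<delta> 1" and "\<pi> \<in> cohomology_class Q ?D ?\<delta> 1 f"
    using P \<pi> by (auto simp: carrier_cohomology)
  then obtain b where "b \<in> carrier (cochains Q ?D 0)"
    and \<pi>_eq: "\<pi> = coboundary Q ?D ?\<delta> 0 b \<otimes>\<^bsub>cochains Q ?D 1\<^esub> f"
    by (auto simp: cohomology_class_def r_coset_def coboundaries_def)
  then have b: "b [] \<in> carrier ?D" by (auto simp: cochains_def tuples_def)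
  have fD: "f [k] \<in> carrier ?D" if "k \<in> carrier Q" for k
    using f that by (auto simp: cocycles_def cochains_def tuples_def dest!: PiE_mem[of _ _ _ "[k]"])
  have \<pi>_val: "\<pi> [k] = (?\<delta> k (b []) \<otimes>\<^bsub>?D\<^esub> inv\<^bsub>?D\<^esub> b []) \<otimes>\<^bsub>?D\<^esub> f [k]" if "k \<in> carrier Q" for k
    using that coboundary_0[where f = b and \<phi> = ?\<delta> and g = k, OF D.comm_group_axioms b dual_action_closed[OF that b] that]
    by (simp add: \<pi>_eq cochains_def tuples_def del: dual_group_simps)
  show "\<pi> [g] \<in> carrier ?D"
    using \<pi>_val[OF g] dual_action_closed[OF g b] b fD[OF g] D.m_closed D.inv_closed by presburger
  assume h: "h \<in> carrier Q" and a: "a \<in> carrier A"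
  let ?a' = "\<phi> (inv\<^bsub>Q\<^esub> g) a"
  have a': "?a' \<in> carrier A" using g a by simp
  have \<pi>_apply: "\<pi> [k] x = b [] (\<phi> (inv\<^bsub>Q\<^esub> k) x) * inverse (b [] x) * f [k] x"
    if "k \<in> carrier Q" "x \<in> carrier A" for k x
    using that b by (simp add: \<pi>_val dual_action_def A.inv_dual_group)
  have "coboundary Q ?D ?\<delta> 1 f [g, h] = \<one>\<^bsub>cochains Q ?D (Suc 1)\<^esub> [g, h]"
    using f by (simp add: cocycles_def)
  also have "\<dots> = \<one>\<^bsub>?D\<^esub>" using g h by (simp add: cochains_def tuples_def)
  finally have "?\<delta> g (f [h]) \<otimes>\<^bsub>?D\<^esub> inv\<^bsub>?D\<^esub> f [g \<otimes>\<^bsub>Q\<^esub> h] \<otimes>\<^bsub>?D\<^esub> f [g] = \<one>\<^bsub>?D\<^esub>"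
    by (simp only: coboundary_1[where f = f and \<phi> = ?\<delta>, OF D.comm_group_axioms Q.is_group g h fD
        dual_action_closed[OF g fD[OF h]]])
  then have "(?\<delta> g (f [h]) \<otimes>\<^bsub>?D\<^esub> inv\<^bsub>?D\<^esub> f [g \<otimes>\<^bsub>Q\<^esub> h] \<otimes>\<^bsub>?D\<^esub> f [g]) a = \<one>\<^bsub>?D\<^esub> a"
    by (rule arg_cong)
  then have "f [h] ?a' * inverse (f [g \<otimes>\<^bsub>Q\<^esub> h] a) * f [g] a = 1"
    using a g h fD by (simp add: dual_action_def A.inv_dual_group)
  moreover have nz: "f [g \<otimes>\<^bsub>Q\<^esub> h] a \<noteq> 0" "b [] ?a' \<noteq> 0"
    using fD[of "g \<otimes>\<^bsub>Q\<^esub> h"] b g h a a' by (auto simp: A.char_nonzero)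
  ultimately have f_mult: "f [g \<otimes>\<^bsub>Q\<^esub> h] a = f [g] a * f [h] ?a'"
    by (simp add: field_simps)
  \<comment> \<open>Here \<open>y\<close> is the value of \<open>b []\<close> at \<open>?a'\<close>;
    it is inserted together with its inverse to separate the factor for \<open>g\<close> from that
    for \<open>h\<close>.\<close>
  have rearrange: "x * u * (v * w) = (y * u * v) * (x * inverse y * w)" if "y \<noteq> 0"
    for u v w x y :: complex
    using that by (simp add: field_simps)
  have "\<phi> (inv\<^bsub>Q\<^esub> (g \<otimes>\<^bsub>Q\<^esub> h)) a = \<phi> (inv\<^bsub>Q\<^esub> h) ?a'"
    using g h a by (simp add: Q.inv_mult_group action_comp)
  then have "\<pi> [g \<otimes>\<^bsub>Q\<^esub> h] a =
      b [] (\<phi> (inv\<^bsub>Q\<^esub> h) ?a') * inverse (b [] a) * (f [g] a * f [h] ?a')"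
    by (simp only: \<pi>_apply[OF Q.m_closed[OF g h] a] f_mult)
  also have "\<dots> = (b [] ?a' * inverse (b [] a) * f [g] a) *
      (b [] (\<phi> (inv\<^bsub>Q\<^esub> h) ?a') * inverse (b [] ?a') * f [h] ?a')"
    by (rule rearrange[OF nz(2)])
  also have "\<dots> = \<pi> [g] a * \<pi> [h] ?a'"
    by (simp only: \<pi>_apply[OF g a] \<pi>_apply[OF h a'])
  finally show "\<pi> [g \<otimes>\<^bsub>Q\<^esub> h] a = \<pi> [g] a * \<pi> [h] ?a'" .
qed

text \<open>The crossed homomorphism rule for \<open>inv g\<close> and \<open>g\<close> shows that
  the twisted map sends \<open>g\<close> to the inverse of the character
  \<open>\<pi> (inv g)\<close>. It is thus \<open>\<pi>\<close> composed with inversion on both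
  sides.\<close>

lemma bij_betw_twisted_crossed_hom:
  assumes bij: "bij_betw \<pi> (carrier Q) (carrier (dual_group A))"
    and \<pi>: "\<And>g h a. g \<in> carrier Q \<Longrightarrow> h \<in> carrier Q \<Longrightarrow> a \<in> carrier A \<Longrightarrow>
      \<pi> (g \<otimes>\<^bsub>Q\<^esub> h) a = \<pi> g a * \<pi> h (\<phi> (inv\<^bsub>Q\<^esub> g) a)"
  shows "bij_betw (\<lambda>g. \<lambda>a \<in> carrier A. \<pi> g (\<phi> g a)) (carrier Q) (carrier (dual_group A))"
proof -
  interpret D: comm_group "dual_group A" by (rule A.comm_group_dual_group)
  have inv_bij: "bij_betw (\<lambda>x. inv\<^bsub>H\<^esub> x) (carrier H) (carrier H)" if "group H" for H :: "('h, 'i) monoid_scheme"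
    using that by (intro bij_betw_byWitness[where f' = "\<lambda>x. inv\<^bsub>H\<^esub> x"])
      (auto simp: group.inv_inv group.inv_closed)
  have \<pi>D: "\<pi> g \<in> carrier (dual_group A)" if "g \<in> carrier Q" for g
    using bij_betwE[OF bij] that by blast
  have "bij_betw (\<lambda>g. inv\<^bsub>dual_group A\<^esub> \<pi> (inv\<^bsub>Q\<^esub> g)) (carrier Q) (carrier (dual_group A))"
    using bij_betw_trans[OF bij_betw_trans[OF inv_bij[OF Q.is_group] bij] inv_bij[OF D.is_group]]
    by (simp add: comp_def)
  moreover have "inv\<^bsub>dual_group A\<^esub> \<pi> (inv\<^bsub>Q\<^esub> g) = (\<lambda>a \<in> carrier A. \<pi> g (\<phi> g a))"
    if g: "g \<in> carrier Q" for g
  proof (rule extensionalityI)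
    show "inv\<^bsub>dual_group A\<^esub> \<pi> (inv\<^bsub>Q\<^esub> g) \<in> extensional (carrier A)"
      using D.inv_closed[OF \<pi>D[of "inv\<^bsub>Q\<^esub> g"]] g by simp
    fix a assume a: "a \<in> carrier A"
    \<comment> \<open>A crossed homomorphism is trivial at the unit, since its value there is a
      nonzero idempotent.\<close>
    have "\<pi> \<one>\<^bsub>Q\<^esub> a * \<pi> \<one>\<^bsub>Q\<^esub> a = \<pi> \<one>\<^bsub>Q\<^esub> a" using \<pi>[of "\<one>\<^bsub>Q\<^esub>" "\<one>\<^bsub>Q\<^esub>" a] a by simp
    moreover have "\<pi> \<one>\<^bsub>Q\<^esub> a \<noteq> 0" using \<pi>D[OF Q.one_closed] a by (simp add: A.char_nonzero)
    ultimately have "\<pi> \<one>\<^bsub>Q\<^esub> a = 1" by simp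
    then have "\<pi> (inv\<^bsub>Q\<^esub> g) a * \<pi> g (\<phi> g a) = 1"
      using \<pi>[of "inv\<^bsub>Q\<^esub> g" g a] g a by simp
    then show "(inv\<^bsub>dual_group A\<^esub> \<pi> (inv\<^bsub>Q\<^esub> g)) a = (\<lambda>a \<in> carrier A. \<pi> g (\<phi> g a)) a"
      using g a \<pi>D[of "inv\<^bsub>Q\<^esub> g"] by (simp add: A.inv_dual_group inverse_unique del: dual_group_simps)
  qed simp
  ultimately show ?thesis by (simp cong: bij_betw_cong del: dual_group_simps)
qed

end

section \<open>Coordinates on an extension with a set-theoretic section\<close>

locale sectioned_extension = group_module A Q \<phi>
  for A :: "('a, 'b) monoid_scheme" (structure) and Q :: "('q, 'c) monoid_scheme" (structure)
    and \<phi> :: "'q \<Rightarrow> 'a \<Rightarrow> 'a" +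
  fixes G :: "('g, 'd) monoid_scheme" (structure) and \<iota> :: "'a \<Rightarrow> 'g" and p :: "'g \<Rightarrow> 'q"
    and s :: "'q \<Rightarrow> 'g"
  assumes extension: "group_extension A Q \<phi> G \<iota> p"
    and section_closed [simp]: "g \<in> carrier Q \<Longrightarrow> s g \<in> carrier G"
    and p_section [simp]: "g \<in> carrier Q \<Longrightarrow> p (s g) = g"
begin

sublocale G: group G
  using extension by (simp add: group_extension_def)

sublocale p: group_hom G Q p
  using extension by unfold_locales (simp add: group_extension_def epi_def)

sublocale \<iota>: group_hom A G \<iota>
  using extension by unfold_locales (simp add: group_extension_def mon_def)

lemma inj_\<iota>: "inj_on \<iota> (carrier A)"
  using extension by (simp add: group_extension_def mon_def)

lemma kernel_p: "x \<in> carrier G \<Longrightarrow> p x = \<one>\<^bsub>Q\<^esub> \<Longrightarrow> x \<in> \<iota> ` carrier A"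
  using extension by (auto simp: group_extension_def kernel_def)

lemma p_\<iota> [simp]: "a \<in> carrier A \<Longrightarrow> p (\<iota> a) = \<one>\<^bsub>Q\<^esub>"
  using extension by (auto simp: group_extension_def kernel_def)

lemma \<iota>_action:
  "g \<in> carrier Q \<Longrightarrow> a \<in> carrier A \<Longrightarrow> \<iota> (\<phi> g a) = s g \<otimes>\<^bsub>G\<^esub> \<iota> a \<otimes>\<^bsub>G\<^esub> inv\<^bsub>G\<^esub> s g"
  using extension by (simp add: group_extension_def)

text \<open>The \<open>A\<close>-component \<open>a\<close> in the factorization
  \<open>x = \<iota> a \<otimes> s (p x)\<close>.\<close>

definition fibre_coord :: "'g \<Rightarrow> 'a" where
  "fibre_coord x = the_inv_into (carrier A) \<iota> (x \<otimes>\<^bsub>G\<^esub> inv\<^bsub>G\<^esub> s (p x))"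

lemma fibre_coord:
  assumes "x \<in> carrier G"
  shows "fibre_coord x \<in> carrier A" and "\<iota> (fibre_coord x) = x \<otimes>\<^bsub>G\<^esub> inv\<^bsub>G\<^esub> s (p x)"
proof -
  have "x \<otimes>\<^bsub>G\<^esub> inv\<^bsub>G\<^esub> s (p x) \<in> \<iota> ` carrier A"
    using assms by (intro kernel_p) simp_all
  then show "fibre_coord x \<in> carrier A" "\<iota> (fibre_coord x) = x \<otimes>\<^bsub>G\<^esub> inv\<^bsub>G\<^esub> s (p x)"
    unfolding fibre_coord_def using inj_\<iota>
    by (auto simp: f_the_inv_into_f intro: the_inv_into_into)
qed

lemma fibre_coord_eqI:
  assumes "x \<in> carrier G" "a \<in> carrier A" "\<iota> a = x \<otimes>\<^bsub>G\<^esub> inv\<^bsub>G\<^esub> s (p x)"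
  shows "fibre_coord x = a"
  using assms fibre_coord[OF assms(1)] inj_\<iota> by (metis inj_onD)

lemma \<iota>_fibre_coord_section:
  "x \<in> carrier G \<Longrightarrow> \<iota> (fibre_coord x) \<otimes>\<^bsub>G\<^esub> s (p x) = x"
  by (simp add: fibre_coord G.m_assoc)

lemma fibre_coord_\<iota>_section:
  "a \<in> carrier A \<Longrightarrow> g \<in> carrier Q \<Longrightarrow> fibre_coord (\<iota> a \<otimes>\<^bsub>G\<^esub> s g) = a"
  by (rule fibre_coord_eqI) (simp_all add: G.m_assoc)

abbreviation \<beta> where "\<beta> \<equiv> factor_set A Q G \<iota> s"

lemma factor_set:
  assumes "g \<in> carrier Q" "h \<in> carrier Q"
  shows "\<beta> [g, h] \<in> carrier A"
    and "\<iota> (\<beta> [g, h]) = s g \<otimes>\<^bsub>G\<^esub> s h \<otimes>\<^bsub>G\<^esub> inv\<^bsub>G\<^esub> s (g \<otimes>\<^bsub>Q\<^esub> h)"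
proof -
  have "\<beta> [g, h] = fibre_coord (s g \<otimes>\<^bsub>G\<^esub> s h)"
    using assms by (simp add: factor_set_def tuples_def fibre_coord_def)
  then show "\<beta> [g, h] \<in> carrier A"
    "\<iota> (\<beta> [g, h]) = s g \<otimes>\<^bsub>G\<^esub> s h \<otimes>\<^bsub>G\<^esub> inv\<^bsub>G\<^esub> s (g \<otimes>\<^bsub>Q\<^esub> h)"
    using assms fibre_coord[of "s g \<otimes>\<^bsub>G\<^esub> s h"] by simp_all
qed

lemma factor_set_cochain: "\<beta> \<in> carrier (cochains Q A 2)"
proof -
  have "\<beta> gs \<in> carrier A" if "gs \<in> tuples Q 2" for gs
    using that factor_set(1) by (auto simp: tuples_def numeral_2_eq_2 length_Suc_conv)
  moreover have "\<beta> \<in> extensional (tuples Q 2)" by (simp add: factor_set_def)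
  ultimately show ?thesis by (auto simp: cochains_def PiE_def)
qed

text \<open>Moving \<open>s (p x)\<close> past \<open>\<iota> (fibre_coord y)\<close> is a
  conjugation, hence the action; recombining \<open>s (p x)\<close> and \<open>s (p y)\<close>
  leaves the factor set.\<close>

lemma fibre_coord_mult:
  assumes x: "x \<in> carrier G" and y: "y \<in> carrier G"
  shows "fibre_coord (x \<otimes>\<^bsub>G\<^esub> y) =
    fibre_coord x \<otimes>\<^bsub>A\<^esub> \<phi> (p x) (fibre_coord y) \<otimes>\<^bsub>A\<^esub> \<beta> [p x, p y]"
proof (rule fibre_coord_eqI)
  have cancel: "inv\<^bsub>G\<^esub> s g \<otimes>\<^bsub>G\<^esub> (s g \<otimes>\<^bsub>G\<^esub> z) = z" if "g \<in> carrier Q" "z \<in> carrier G" for g z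
    using that by (simp flip: G.m_assoc)
  show "\<iota> (fibre_coord x \<otimes>\<^bsub>A\<^esub> \<phi> (p x) (fibre_coord y) \<otimes>\<^bsub>A\<^esub> \<beta> [p x, p y]) =
      x \<otimes>\<^bsub>G\<^esub> y \<otimes>\<^bsub>G\<^esub> inv\<^bsub>G\<^esub> s (p (x \<otimes>\<^bsub>G\<^esub> y))"
    using x y by (simp add: fibre_coord factor_set \<iota>_action G.m_assoc cancel)
qed (use x y in \<open>simp_all add: fibre_coord factor_set\<close>)

text \<open>A fibre of \<open>p\<close> is a coset of the image of \<open>A\<close>. Sums over
  fibres thereby become sums over \<open>A\<close> in row orthogonality.\<close>

lemma bij_betw_fibre_coord:
  assumes "g \<in> carrier Q"
  shows "bij_betw fibre_coord {x \<in> carrier G. p x = g} (carrier A)"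
  using assms \<iota>_fibre_coord_section
  by (intro bij_betw_byWitness[where f' = "\<lambda>a. \<iota> a \<otimes>\<^bsub>G\<^esub> s g"])
    (auto simp: fibre_coord_\<iota>_section fibre_coord(1))

lemma finite_carrier:
  assumes "finite (carrier A)" "finite (carrier Q)"
  shows "finite (carrier G)"
proof (rule finite_subset)
  show "carrier G \<subseteq> (\<lambda>(a, g). \<iota> a \<otimes>\<^bsub>G\<^esub> s g) ` (carrier A \<times> carrier Q)"
  proof
    fix x assume "x \<in> carrier G"
    then show "x \<in> (\<lambda>(a, g). \<iota> a \<otimes>\<^bsub>G\<^esub> s g) ` (carrier A \<times> carrier Q)"
      using fibre_coord(1)[of x] \<iota>_fibre_coord_section[of x]
      by (intro image_eqI[of _ _ "(fibre_coord x, p x)"]) auto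
  qed
qed (use assms in simp)

text \<open>The hypothesis \<open>cup\<close> equates the coboundary of \<open>f\<close> with the
  cup cochain, with denominators cleared. It makes the monomial matrices projectively
  multiplicative.\<close>

lemma central_type_extension:
  assumes fin: "finite (carrier A)" "finite (carrier Q)"
    and bij: "bij_betw \<pi> (carrier Q) (carrier (dual_group A))"
    and \<pi>: "\<And>g h a. g \<in> carrier Q \<Longrightarrow> h \<in> carrier Q \<Longrightarrow> a \<in> carrier A \<Longrightarrow>
      \<pi> (g \<otimes>\<^bsub>Q\<^esub> h) a = \<pi> g a * \<pi> h (\<phi> (inv\<^bsub>Q\<^esub> g) a)"
    and f_nz: "\<And>g h. g \<in> carrier Q \<Longrightarrow> h \<in> carrier Q \<Longrightarrow> f [g, h] \<noteq> 0"
    and cup: "\<And>g h k. g \<in> carrier Q \<Longrightarrow> h \<in> carrier Q \<Longrightarrow> k \<in> carrier Q \<Longrightarrow>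
      \<pi> g (\<phi> g (\<beta> [h, k])) * f [g \<otimes>\<^bsub>Q\<^esub> h, k] * f [g, h] = f [h, k] * f [g, h \<otimes>\<^bsub>Q\<^esub> k]"
  shows "central_type G"
proof -
  have \<pi>D: "\<pi> g \<in> hom A Cstar" if "g \<in> carrier Q" for g
    using bij_betwE[OF bij] that by auto
  have \<pi>_nz: "\<pi> g (\<phi> h a) \<noteq> 0" if "g \<in> carrier Q" "h \<in> carrier Q" "a \<in> carrier A" for g h a
    using A.char_nonzero[OF \<pi>D[OF that(1)]] that by simp
  \<comment> \<open>These characters supply the rows of the matrices; by the twisted bijection they
    exhaust the dual group.\<close>
  define \<chi> where "\<chi> m = (\<lambda>a \<in> carrier A. \<pi> m (\<phi> m a))" for m
  have \<chi>_bij: "bij_betw \<chi> (carrier Q) (carrier (dual_group A))"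
    unfolding \<chi>_def using bij_betw_twisted_crossed_hom[OF bij] \<pi> by blast
  have \<chi>D: "\<chi> m \<in> carrier (dual_group A)" if "m \<in> carrier Q" for m
    using bij_betwE[OF \<chi>_bij] that by blast
  \<comment> \<open>Bijectivity of \<open>\<pi>\<close> makes the constants of the two orthogonality
    relations agree.\<close>
  have order: "order A = order Q"
    using A.order_dual_group[OF fin(1)] bij_betw_same_card[OF bij] by (simp add: order_def)
  define t where "t x m = \<pi> m (\<phi> m (fibre_coord x)) / f [m, p x]" for x m
  \<comment> \<open>This is the quotient of \<open>t x m * t y (m \<otimes> p x)\<close> by
    \<open>t (x \<otimes> y) m\<close>; the dependence on \<open>m\<close> cancels by the crossed
    homomorphism rule and the cup equation.\<close>
  define c where "c = (\<lambda>gs \<in> tuples G 2.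
    \<pi> (p (gs ! 0)) (\<phi> (p (gs ! 0)) (fibre_coord (gs ! 1))) / f [p (gs ! 0), p (gs ! 1)])"
  have c_eq: "c [x, y] = \<pi> (p x) (\<phi> (p x) (fibre_coord y)) / f [p x, p y]"
    if "x \<in> carrier G" "y \<in> carrier G" for x y
    using that by (simp add: c_def tuples_def)
  have t_\<chi>: "t x m = \<chi> m (fibre_coord x) / f [m, p x]" if "x \<in> carrier G" for x m
    using that by (simp add: t_def \<chi>_def fibre_coord)
  interpret monomial_rep G Q p t c
  proof
    show "finite (carrier G)" by (rule finite_carrier[OF fin])
    show "finite (carrier Q)" by (rule fin)
    show "p \<in> hom G Q" by (rule p.homh)
  next
    fix x m assume "x \<in> carrier G" "m \<in> carrier Q"
    then show "t x m \<noteq> 0" using f_nz \<pi>_nz by (simp add: t_def fibre_coord)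
  next
    fix x y m assume x: "x \<in> carrier G" and y: "y \<in> carrier G" and m: "m \<in> carrier Q"
    let ?a = "fibre_coord x" and ?b = "fibre_coord y" and ?g = "p x" and ?h = "p y"
    note [simp] = fibre_coord(1) factor_set(1)
    \<comment> \<open>The rule for \<open>\<pi>\<close> applies the inverse of \<open>m\<close> in
      its second factor, which cancels the outer action of \<open>m\<close>.\<close>
    have 1: "\<pi> (m \<otimes>\<^bsub>Q\<^esub> ?g) (\<phi> (m \<otimes>\<^bsub>Q\<^esub> ?g) ?b) = \<pi> m (\<phi> m (\<phi> ?g ?b)) * \<pi> ?g (\<phi> ?g ?b)"
      using x y m by (simp add: \<pi> action_comp)
    have 2: "\<pi> m (\<phi> m (fibre_coord (x \<otimes>\<^bsub>G\<^esub> y))) =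
        \<pi> m (\<phi> m ?a) * \<pi> m (\<phi> m (\<phi> ?g ?b)) * \<pi> m (\<phi> m (\<beta> [?g, ?h]))"
      using x y m by (simp add: fibre_coord_mult action_mult A.char_mult[OF \<pi>D])
    have divide: "v = w * x / (y * z)" if "v * y * z = w * x" "y \<noteq> 0" "z \<noteq> 0"
      for v w x y z :: complex
      using that by (simp add: field_simps)
    have 3: "\<pi> m (\<phi> m (\<beta> [?g, ?h])) =
        f [?g, ?h] * f [m, ?g \<otimes>\<^bsub>Q\<^esub> ?h] / (f [m \<otimes>\<^bsub>Q\<^esub> ?g, ?h] * f [m, ?g])"
      by (rule divide) (use cup[of m ?g ?h] x y m in \<open>simp_all add: f_nz\<close>)
    have rearrange: "\<alpha> / v * (\<delta> * \<gamma> / w) = \<gamma> / y * (\<alpha> * \<delta> * (y * z / (w * v)) / z)"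
      if "v \<noteq> 0" "w \<noteq> 0" "y \<noteq> 0" "z \<noteq> 0" for \<alpha> \<delta> \<gamma> v w y z :: complex
      using that by (simp add: field_simps)
    show "t x m * t y (m \<otimes>\<^bsub>Q\<^esub> p x) = c [x, y] * t (x \<otimes>\<^bsub>G\<^esub> y) m"
      unfolding t_def c_eq[OF x y] 1 2 3 p.hom_mult[OF x y]
      by (rule rearrange) (use x y m in \<open>simp_all add: f_nz\<close>)
  next
    fix x y assume x: "x \<in> carrier G" and y: "y \<in> carrier G" and eq: "p x = p y"
    \<comment> \<open>The factors from \<open>f\<close> cancel because \<open>x\<close> and
      \<open>y\<close> have the same image, and reindexing along \<open>\<chi>\<close> turns a sum
      over \<open>Q\<close> into one over all characters.\<close>
    have "(\<Sum>m \<in> carrier Q. t x m / t y m) =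
        (\<Sum>m \<in> carrier Q. \<chi> m (fibre_coord x) / \<chi> m (fibre_coord y))"
      using x y f_nz by (intro sum.cong) (auto simp: t_\<chi> eq)
    also have "\<dots> = (\<Sum>\<theta> \<in> carrier (dual_group A). \<theta> (fibre_coord x) / \<theta> (fibre_coord y))"
      by (rule sum.reindex_bij_betw[OF \<chi>_bij])
    also have "\<dots> = (if fibre_coord x = fibre_coord y then of_nat (order Q) else 0)"
      using x y fin order by (simp add: A.column_orthogonality fibre_coord(1) del: dual_group_simps)
    also have "fibre_coord x = fibre_coord y \<longleftrightarrow> x = y"
      using \<iota>_fibre_coord_section[OF x] \<iota>_fibre_coord_section[OF y] eq by metis
    finally show "(\<Sum>m \<in> carrier Q. t x m / t y m) = (if x = y then of_nat (order Q) else 0)" .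
  next
    fix g m l assume g: "g \<in> carrier Q" and m: "m \<in> carrier Q" and l: "l \<in> carrier Q"
    \<comment> \<open>The quotient of the factors from \<open>f\<close> is constant on the fibre and
      equals 1 for \<open>m = l\<close>; injectivity of \<open>\<chi>\<close> turns equality of
      characters into equality of rows.\<close>
    have "(\<Sum>x | x \<in> carrier G \<and> p x = g. t x m / t x l) =
        (\<Sum>x | x \<in> carrier G \<and> p x = g.
          f [l, g] / f [m, g] * (\<chi> m (fibre_coord x) / \<chi> l (fibre_coord x)))"
      by (intro sum.cong) (auto simp: t_\<chi> mult_ac)
    also have "\<dots> = (\<Sum>a \<in> carrier A. f [l, g] / f [m, g] * (\<chi> m a / \<chi> l a))"
      by (rule sum.reindex_bij_betw[OF bij_betw_fibre_coord[OF g]])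
    also have "\<dots> = f [l, g] / f [m, g] * (if \<chi> m = \<chi> l then of_nat (order A) else 0)"
      using A.row_orthogonality[OF fin(1) \<chi>D[OF m] \<chi>D[OF l]]
      by (simp only: sum_distrib_left[symmetric])
    also have "\<dots> = (if m = l then of_nat (order Q) else 0)"
      using inj_onD[OF bij_betw_imp_inj_on[OF \<chi>_bij] _ m l] f_nz[OF l g] order by auto
    finally show "(\<Sum>x | x \<in> carrier G \<and> p x = g. t x m / t x l) =
        (if m = l then of_nat (order Q) else 0)" .
  qed
  have "c gs \<noteq> 0" if "gs \<in> tuples G 2" for gs
    using that c_nonzero by (auto simp: tuples_def numeral_2_eq_2 length_Suc_conv)
  then have "c \<in> carrier (cochains G Cstar 2)"
    by (auto simp: cochains_def PiE_def c_def)
  then show ?thesis by (rule central_type_G)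
qed

end

section \<open>Passage from cohomology classes to cochains\<close>

theorem corollaryB:
  fixes A :: "('a, 'b) monoid_scheme"
    and Q :: "('q, 'c) monoid_scheme"
    and G :: "('g, 'd) monoid_scheme"
    and \<phi> :: "'q \<Rightarrow> 'a \<Rightarrow> 'a"
    and \<iota> :: "'a \<Rightarrow> 'g"
    and p :: "'g \<Rightarrow> 'q"
    and P :: "('q list \<Rightarrow> 'a \<Rightarrow> complex) set"
    and B :: "('q list \<Rightarrow> 'a) set"
  assumes "comm_group A" and "finite (carrier A)"
    and "group Q" and "finite (carrier Q)"
    and "\<phi> \<in> hom Q (AutoGroup A)"
    and "P \<in> carrier (cohomology Q (dual_group A) (dual_action Q A \<phi>) 1)"
    and "bijective_class Q A P"
    and "B \<in> carrier (cohomology Q A \<phi> 2)"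
    and "cup_class Q \<phi> B P = \<one>\<^bsub>cohomology Q Cstar trivial_action 3\<^esub>"
    and "group_extension A Q \<phi> G \<iota> p"
    and "extension_has_class A Q \<phi> G \<iota> p B"
  shows "central_type G"
proof -
  obtain \<pi> where \<pi>: "\<pi> \<in> P" "bij_betw (\<lambda>g. \<pi> [g]) (carrier Q) (carrier (dual_group A))"
    using assms(7) by (auto simp: bijective_class_def)
  obtain s where s: "\<And>g. g \<in> carrier Q \<Longrightarrow> s g \<in> carrier G \<and> p (s g) = g"
    and B: "cohomology_class Q A \<phi> 2 (factor_set A Q G \<iota> s) = B"
    using assms(11) by (auto simp: extension_has_class_def)
  interpret group_module A Q \<phi>
    using assms by (simp add: group_module_def group_module_axioms_def)
  interpret sectioned_extension A Q \<phi> G \<iota> p s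
    using assms(10) s by unfold_locales auto
  have \<pi>D: "\<pi> [g] \<in> carrier (dual_group A)" if "g \<in> carrier Q" for g
    using crossed_hom_of_class(1)[OF assms(6) \<pi>(1) that] .
  \<comment> \<open>The factor set of the chosen section itself represents \<open>B\<close>, so the
    cup product can be computed with it.\<close>
  have "\<beta> \<in> B"
    using cochain_in_cohomology_class[OF assms(1,3), of \<phi> \<beta> 1] factor_set_cochain B
    by (simp add: numeral_2_eq_2)
  let ?cup = "cup_cochain Q \<phi> \<beta> \<pi>"
  have "?cup gs \<noteq> 0" if gs: "gs \<in> tuples Q 3" for gs
    using gs \<pi>D factor_set(1)
    by (auto simp: tuples_def numeral_3_eq_3 length_Suc_conv cup_cochain_def A.char_nonzero)
  then have "?cup \<in> carrier (cochains Q Cstar 3)"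
    by (auto simp: cochains_def PiE_def cup_cochain_def)
  then have "?cup \<in> cohomology_class Q Cstar trivial_action 3 ?cup"
    using cochain_in_cohomology_class[OF comm_group_Cstar assms(3), of trivial_action ?cup 2]
    by (simp add: trivial_action_def numeral_3_eq_3 numeral_2_eq_2)
  \<comment> \<open>The union defining the product contains the class of this cochain. As that union
    equals the set of coboundaries, \<open>?cup\<close> has a primitive \<open>f\<close>.\<close>
  then have "?cup \<in> cup_class Q \<phi> B P"
    using \<open>\<beta> \<in> B\<close> \<pi>(1) unfolding cup_class_def by blast
  then have "?cup \<in> coboundaries Q Cstar trivial_action (Suc 2)"
    using assms(9) by (simp add: one_cohomology numeral_3_eq_3 numeral_2_eq_2)
  then obtain f where f: "f \<in> carrier (cochains Q Cstar 2)"
    and cup_f: "?cup = coboundary Q Cstar trivial_action 2 f"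
    unfolding coboundaries_def by auto
  have f_nz: "f [g, h] \<noteq> 0" if "g \<in> carrier Q" "h \<in> carrier Q" for g h
    using PiE_mem[of f "tuples Q 2" "\<lambda>_. carrier Cstar" "[g, h]"] f that
    by (simp add: cochains_def tuples_def)
  show ?thesis
  proof (rule central_type_extension[where \<pi> = "\<lambda>g. \<pi> [g]" and f = f])
    fix g h k assume *: "g \<in> carrier Q" "h \<in> carrier Q" "k \<in> carrier Q"
    have cancel: "u * (inverse v * w) * inverse x * v * x = u * w" if "v \<noteq> 0" "x \<noteq> 0"
      for u v w x :: complex
      using that by (simp add: field_simps)
    have "\<pi> [g] (\<phi> g (\<beta> [h, k])) = ?cup [g, h, k]"
      using * by (simp add: cup_cochain_def tuples_def)
    also have "\<dots> = f [h, k] * (inverse (f [g \<otimes>\<^bsub>Q\<^esub> h, k]) * f [g, h \<otimes>\<^bsub>Q\<^esub> k]) * inverse (f [g, h])"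
      unfolding cup_f using * f_nz
      by (subst coboundary_2[OF comm_group_Cstar assms(3)]) (auto simp: trivial_action_def)
    finally have eq: "\<pi> [g] (\<phi> g (\<beta> [h, k])) =
        f [h, k] * (inverse (f [g \<otimes>\<^bsub>Q\<^esub> h, k]) * f [g, h \<otimes>\<^bsub>Q\<^esub> k]) * inverse (f [g, h])" .
    show "\<pi> [g] (\<phi> g (\<beta> [h, k])) * f [g \<otimes>\<^bsub>Q\<^esub> h, k] * f [g, h] =
        f [h, k] * f [g, h \<otimes>\<^bsub>Q\<^esub> k]"
      unfolding eq by (rule cancel) (use * in \<open>simp_all add: f_nz\<close>)
  qed (use assms(2,4) \<pi>(2) f_nz crossed_hom_of_class(2)[OF assms(6) \<pi>(1)] in auto)
qed

end
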